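(* For each integer $t\ge 1$ let $S_{\mathrm a}(t)$ be the number of $3\times 3$ semimagic squares with magic sum $t$. Then $\sum_{t>0} S_{\mathrm a}(t)\,x^t$ equals $$\frac{72x^{15}\,A(x)}{(1-x^3)^2(1-x^4)(1-x^5)(1-x^6)(1-x^7)(1-x^8)},$$ where $$A(x)=18x^{21}+5x^{20}+15x^{19}+11x^{17}-8x^{16}+x^{15}-23x^{14}-13x^{13}-22x^{12}-9x^{11}-16x^{10}+x^9-3x^8+7x^7+7x^6+9x^5+7x^4+6x^3+4x^2+2x+1.$$ Moreover, for every integer $t\ge1$, $$S_{\mathrm a}(t)=\tfrac18t^4-\tfrac92t^3+a_2(t)\,t^2-a_1(t)\,t+a_0(t)-72\,S_7(t),$$ where $S_7(t)=\left\lfloor\frac{t-1}{21}\right\rfloor+\epsilon(t)$ with $\epsilon(t)=1$ if $t\equiv 10,13,16,17,19,20\pmod{21}$ and $\epsilon(t)=0$ otherwise; $a_2(t)=\frac{243}{4}$ if $t\equiv0$; $\frac{218}{4}$ if $t\equiv1,5$; $\frac{227}{4}$ if $t\equiv2,4$; $\frac{234}{4}$ if $t\equiv3\pmod 6$; $a_1(t)=\frac{1968}{5}$ if $t\equiv0$; $\frac{1158}{5}$ if $t\equiv1,5$; $\frac{1383}{5}$ if $t\equiv2,10$; $\frac{1653}{5}$ if $t\equiv3$; $\frac{1428}{5}$ if $t\equiv4,8$; $\frac{1923}{5}$ if $t\equiv6$; $\frac{1113}{5}$ if $t\equiv7,11$; $\frac{1698}{5}$ if $t\equiv9\pmod{12}$;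 and $a_0(t)$ depends only on $t$ modulo $120$ and is given as follows, where in the line for $r$ the six numbers are the values of $a_0$ at $t\equiv r,\ r+20,\ r+40,\ r+60,\ r+80,\ r+100\pmod{120}$, in this order: $r=0$: $1224,\ 524,\ 584,\ 1188,\ 560,\ 548$; $r=1$: $\frac{7259}{40},\ \frac{31419}{40},\ \frac{6299}{40},\ \frac{8699}{40},\ \frac{29979}{40},\ \frac{7739}{40}$; $r=2$: $\frac{1801}{5},\ \frac{1741}{5},\ \frac{5121}{5},\ \frac{1621}{5},\ \frac{1921}{5},\ \frac{4941}{5}$; $r=3$: $\frac{23067}{40},\ \frac{827}{40},\ \frac{347}{40},\ \frac{24507}{40},\ \frac{-613}{40},\ \frac{1787}{40}$; $r=4$: $\frac{2452}{5},\ \frac{5832}{5},\ \frac{2332}{5},\ \frac{2632}{5},\ \frac{5652}{5},\ \frac{2512}{5}$; $r=5$: $\frac{2239}{8},\ \frac{2143}{8},\ \frac{6975}{8},\ \frac{1951}{8},\ \frac{2431}{8},\ \frac{6687}{8}$; $r=6$: $\frac{4653}{5},\ \frac{1513}{5},\ \frac{1453}{5},\ \frac{4833}{5},\ \frac{1333}{5},\ \frac{1633}{5}$; $r=7$: $\frac{5243}{40},\ \frac{26523}{40},\ \frac{4283}{40},\ \frac{3803}{40},\ \frac{27963}{40},\ \frac{2843}{40}$; $r=8$: $\frac{2224}{5},\ \frac{2164}{5},\ \frac{5544}{5},\ \frac{2044}{5},\ \frac{2344}{5},\ \frac{5364}{5}$; $r=9$: $\frac{31131}{40},\ \frac{8891}{40},\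 \frac{8411}{40},\ \frac{32571}{40},\ \frac{7451}{40},\ \frac{9851}{40}$; $r=10$: $413,\ 1017,\ 389,\ 377,\ 1053,\ 353$; $r=11$: $\frac{539}{40},\ \frac{2939}{40},\ \frac{24219}{40},\ \frac{1979}{40},\ \frac{1499}{40},\ \frac{25659}{40}$; $r=12$: $\frac{5796}{5},\ \frac{2656}{5},\ \frac{2596}{5},\ \frac{5976}{5},\ \frac{2476}{5},\ \frac{2776}{5}$; $r=13$: $\frac{7547}{40},\ \frac{28827}{40},\ \frac{6587}{40},\ \frac{6107}{40},\ \frac{30267}{40},\ \frac{5147}{40}$; $r=14$: $\frac{1477}{5},\ \frac{1777}{5},\ \frac{4797}{5},\ \frac{1657}{5},\ \frac{1597}{5},\ \frac{4977}{5}$; $r=15$: $\frac{5823}{8},\ \frac{799}{8},\ \frac{1279}{8},\ \frac{5535}{8},\ \frac{1087}{8},\ \frac{991}{8}$; $r=16$: $\frac{2488}{5},\ \frac{5508}{5},\ \frac{2368}{5},\ \frac{2308}{5},\ \frac{5688}{5},\ \frac{2188}{5}$; $r=17$: $\frac{8603}{40},\ \frac{11003}{40},\ \frac{32283}{40},\ \frac{10043}{40},\ \frac{9563}{40},\ \frac{33723}{40}$; $r=18$: $\frac{4689}{5},\ \frac{1189}{5},\ \frac{1489}{5},\ \frac{4509}{5},\ \frac{1369}{5},\ \frac{1309}{5}$; $r=19$: $\frac{2651}{40},\ \frac{26811}{40},\ \frac{1691}{40},\ \frac{4091}{40},\ \frac{25371}{40},\ \frac{3131}{40}$. The quasipolynomial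 $S_{\mathrm a}$ has period exactly $840$, and its principal constituent is $\frac18t^4-\frac92t^3+\frac{243}{4}t^2-\frac{13896}{35}t+1296$.
   Context: A $3\times3$ semimagic square (in the strong sense) is a $3\times 3$ matrix of pairwise distinct positive integers in which all three row sums and all three column sums are equal; the common value is the magic sum. Squares are counted as matrices (not up to symmetry). A function $N$ of $t\in\mathbb Z_{>0}$ is a quasipolynomial if there are a positive integer $p$ and polynomials $N_0,\dots,N_{p-1}$ (the constituents) with $N(t)=N_{t \bmod p}(t)$; the minimal such $p$ is the period, and $N_0$ is the principal constituent. *)

theory Defs
  imports "HOL-Analysis.Analysis" "HOL-Computational_Algebra.Computational_Algebra"
begin

section \<open>Semimagic squares\<close>

definition semimagic_square :: "int ^ 3 ^ 3 \<Rightarrow> int \<Rightarrow> bool" where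
  "semimagic_square M s \<longleftrightarrow>
     (\<forall>i j. 0 < M $ i $ j) \<and>
     inj (\<lambda>(i, j). M $ i $ j) \<and>
     (\<forall>i. (\<Sum>j\<in>UNIV. M $ i $ j) = s) \<and>
     (\<forall>j. (\<Sum>i\<in>UNIV. M $ i $ j) = s)"

definition Sa :: "nat \<Rightarrow> nat" where
  "Sa t = card {M. semimagic_square M (int t)}"

text \<open>The set counted by \<^const>\<open>Sa\<close> is finite, so its \<^const>\<open>card\<close> is a genuine count.\<close>

lemma finite_vec_of_finite:
  assumes "finite B"
  shows "finite {v :: 'a ^ 'n. \<forall>i. v $ i \<in> B}"
proof -
  have "finite (PiE (UNIV :: 'n set) (\<lambda>_. B))"
    by (intro finite_PiE) (use assms in auto)
  then have "finite (vec_lambda ` (PiE (UNIV :: 'n set) (\<lambda>_. B)))" by blast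
  moreover have "{v :: 'a ^ 'n. \<forall>i. v $ i \<in> B} \<subseteq> vec_lambda ` (PiE UNIV (\<lambda>_. B))"
  proof
    fix v :: "'a ^ 'n" assume "v \<in> {v. \<forall>i. v $ i \<in> B}"
    then have "vec_nth v \<in> PiE UNIV (\<lambda>_. B)" by auto
    moreover have "v = vec_lambda (vec_nth v)" by simp
    ultimately show "v \<in> vec_lambda ` (PiE UNIV (\<lambda>_. B))" by blast
  qed
  ultimately show ?thesis by (rule rev_finite_subset)
qed

lemma finite_semimagic_squares: "finite {M. semimagic_square M s}"
proof -
  have fin1: "finite {v :: int ^ 3. \<forall>j. v $ j \<in> {0..s}}"
    by (rule finite_vec_of_finite) simp
  have "finite {M :: int ^ 3 ^ 3. \<forall>i. M $ i \<in> {v. \<forall>j. v $ j \<in> {0..s}}}"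
    by (rule finite_vec_of_finite) (use fin1 in simp)
  moreover have "{M. semimagic_square M s} \<subseteq>
      {M :: int ^ 3 ^ 3. \<forall>i. M $ i \<in> {v. \<forall>j. v $ j \<in> {0..s}}}"
  proof (safe, unfold atLeastAtMost_iff)
    fix M i j assume M: "semimagic_square M s"
    have pos: "\<And>i j. 0 \<le> M $ i $ j" and row: "(\<Sum>j\<in>UNIV. M $ i $ j) = s"
      using M by (auto simp: semimagic_square_def less_imp_le)
    show "0 \<le> M $ i $ j \<and> M $ i $ j \<le> s"
      using pos member_le_sum[of j UNIV "\<lambda>j. M $ i $ j"] row by auto
  qed
  ultimately show ?thesis by (rule rev_finite_subset)
qed


section \<open>Quasipolynomials\<close>

text \<open>Functions on the positive integers are represented as functions on \<^typ>\<open>nat\<close> whose value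
  at \<open>0\<close> is ignored. Only \<open>c 0\<close> up to \<open>c (p - 1)\<close> matter in the next definition.\<close>

definition has_constituents :: "(nat \<Rightarrow> real) \<Rightarrow> nat \<Rightarrow> (nat \<Rightarrow> real poly) \<Rightarrow> bool" where
  "has_constituents N p c \<longleftrightarrow> p > 0 \<and> (\<forall>t>0. N t = poly (c (t mod p)) (real t))"

definition quasipolynomial :: "(nat \<Rightarrow> real) \<Rightarrow> bool" where
  "quasipolynomial N \<longleftrightarrow> (\<exists>p c. has_constituents N p c)"

definition quasi_period :: "(nat \<Rightarrow> real) \<Rightarrow> nat" where
  "quasi_period N = (LEAST p. \<exists>c. has_constituents N p c)"

definition principal_constituent :: "(nat \<Rightarrow> real) \<Rightarrow> real poly" where
  "principal_constituent N = (THE q. \<exists>c. has_constituents N (quasi_period N) c \<and> q = c 0)"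

text \<open>The principal constituent is well defined, and may be computed from any admissible \<open>p\<close>.\<close>

lemma has_constituents_0_unique:
  assumes "has_constituents N p c" "has_constituents N q d"
  shows "c 0 = d 0"
proof -
  have pq: "p > 0" "q > 0" using assms by (auto simp: has_constituents_def)
  have eq: "poly (c 0 - d 0) (real (p * q * Suc n)) = 0" for n
  proof -
    have "p * q * Suc n > 0" using pq by simp
    then have "N (p * q * Suc n) = poly (c 0) (real (p * q * Suc n))"
      and "N (p * q * Suc n) = poly (d 0) (real (p * q * Suc n))"
      using assms unfolding has_constituents_def by (metis mod_mult_self1_is_0 mult.assoc mult.commute)+
    then show ?thesis by simp
  qed
  have "inj (\<lambda>n. real (p * q * Suc n))"
    using pq by (auto intro!: injI)
  then have "infinite (range (\<lambda>n. real (p * q * Suc n)))"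
    using range_inj_infinite by blast
  moreover have "range (\<lambda>n. real (p * q * Suc n)) \<subseteq> {x. poly (c 0 - d 0) x = 0}"
    using eq by blast
  ultimately have "infinite {x. poly (c 0 - d 0) x = 0}"
    using infinite_super by blast
  then show ?thesis
    using poly_roots_finite[of "c 0 - d 0"] by auto
qed

lemma principal_constituent_eq:
  assumes "has_constituents N p c"
  shows "principal_constituent N = c 0"
proof -
  have "\<exists>c. has_constituents N (quasi_period N) c"
    unfolding quasi_period_def by (rule LeastI[of _ p]) (use assms in blast)
  then obtain d where d: "has_constituents N (quasi_period N) d" by blast
  have "principal_constituent N = d 0"
    unfolding principal_constituent_def
    by (rule the_equality) (use d has_constituents_0_unique in blast)+
  then show ?thesis using has_constituents_0_unique[OF d assms] by simp
qed


section \<open>The explicit data\<close>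

definition A_num :: "'a::comm_ring_1 \<Rightarrow> 'a" where
  "A_num x =
     18 * x ^ 21 + 5 * x ^ 20 + 15 * x ^ 19 + 11 * x ^ 17 - 8 * x ^ 16 + x ^ 15 - 23 * x ^ 14
     - 13 * x ^ 13 - 22 * x ^ 12 - 9 * x ^ 11 - 16 * x ^ 10 + x ^ 9 - 3 * x ^ 8 + 7 * x ^ 7
     + 7 * x ^ 6 + 9 * x ^ 5 + 7 * x ^ 4 + 6 * x ^ 3 + 4 * x ^ 2 + 2 * x + 1"

definition eps7 :: "nat \<Rightarrow> int" where
  "eps7 t = (if t mod 21 \<in> {10, 13, 16, 17, 19, 20} then 1 else 0)"

definition S7 :: "nat \<Rightarrow> int" where
  "S7 t = \<lfloor>(real t - 1) / 21\<rfloor> + eps7 t"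

definition a2 :: "nat \<Rightarrow> real" where
  "a2 t = (let r = t mod 6 in
     if r = 0 then 243/4
     else if r \<in> {1, 5} then 218/4
     else if r \<in> {2, 4} then 227/4
     else 234/4)"

definition a1 :: "nat \<Rightarrow> real" where
  "a1 t = (let r = t mod 12 in
     if r = 0 then 1968/5
     else if r \<in> {1, 5} then 1158/5
     else if r \<in> {2, 10} then 1383/5
     else if r = 3 then 1653/5
     else if r \<in> {4, 8} then 1428/5
     else if r = 6 then 1923/5
     else if r \<in> {7, 11} then 1113/5
     else 1698/5)"

text \<open>Row \<open>r\<close> (for \<open>r < 20\<close>) lists the values of \<open>a0 t\<close> for \<open>t\<close> congruent to
  \<open>r\<close>, \<open>r + 20\<close>, \<open>r + 40\<close>, \<open>r + 60\<close>, \<open>r + 80\<close>, \<open>r + 100\<close> modulo \<open>120\<close>.\<close>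

definition a0_table :: "real list list" where
  "a0_table =
  [
   [1224, 524, 584, 1188, 560, 548],
   [7259/40, 31419/40, 6299/40, 8699/40, 29979/40, 7739/40],
   [1801/5, 1741/5, 5121/5, 1621/5, 1921/5, 4941/5],
   [23067/40, 827/40, 347/40, 24507/40, - 613/40, 1787/40],
   [2452/5, 5832/5, 2332/5, 2632/5, 5652/5, 2512/5],
   [2239/8, 2143/8, 6975/8, 1951/8, 2431/8, 6687/8],
   [4653/5, 1513/5, 1453/5, 4833/5, 1333/5, 1633/5],
   [5243/40, 26523/40, 4283/40, 3803/40, 27963/40, 2843/40],
   [2224/5, 2164/5, 5544/5, 2044/5, 2344/5, 5364/5],
   [31131/40, 8891/40, 8411/40, 32571/40, 7451/40, 9851/40],
   [413, 1017, 389, 377, 1053, 353],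
   [539/40, 2939/40, 24219/40, 1979/40, 1499/40, 25659/40],
   [5796/5, 2656/5, 2596/5, 5976/5, 2476/5, 2776/5],
   [7547/40, 28827/40, 6587/40, 6107/40, 30267/40, 5147/40],
   [1477/5, 1777/5, 4797/5, 1657/5, 1597/5, 4977/5],
   [5823/8, 799/8, 1279/8, 5535/8, 1087/8, 991/8],
   [2488/5, 5508/5, 2368/5, 2308/5, 5688/5, 2188/5],
   [8603/40, 11003/40, 32283/40, 10043/40, 9563/40, 33723/40],
   [4689/5, 1189/5, 1489/5, 4509/5, 1369/5, 1309/5],
   [2651/40, 26811/40, 1691/40, 4091/40, 25371/40, 3131/40]
  ]"

definition a0 :: "nat \<Rightarrow> real" where
  "a0 t = a0_table ! (t mod 20) ! (t mod 120 div 20)"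

end

theory Submission
  imports Defs "HOL-Number_Theory.Cong"
begin

text \<open>
  Permuting rows and columns and transposing, every square is brought in exactly one of 72 ways into
  the form with least entry \<open>m\<close> in the corner, increasing first row and first column, and (1,2) entry
  smaller than (2,1) entry. Such a square is \<open>m\<close> plus the matrix with rows \<open>(0, x+y, x+y+2u+v)\<close>,
  \<open>(x+y+u, y+u+v, x)\<close>, \<open>(x+y+u+v, x+u, y)\<close> for positive \<open>x, y, u, v\<close>, its magic sum is
  \<open>3m+2x+2y+2u+v\<close>, and its entries are distinct iff \<open>(x, y, u, v)\<close> avoids seven hyperplanes.
  Each hyperplane equation expresses one variable as a sum of others, so all flats of this arrangement
  inside the open orthant are parametrized by smaller orthants, with generating functions
  \<open>\<Prod> X^a / (1 - X^a)\<close>; inclusion-exclusion over the flats gives the generating function.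

  For the explicit formula, \<open>S7\<close> counts the positive solutions of \<open>3a + 7b = t\<close>, so that the term
  \<open>- 72 * S7\<close> is the contribution of the line \<open>x = y = u = v\<close>, and \<open>a0\<close> splits into
  a function of \<open>t mod 24\<close> and one of \<open>t mod 5\<close>; the three resulting parts are matched with
  partial fractions of the generating function by checking linear recurrences.
\<close>

section \<open>Symmetry and parametrization\<close>

lemma card_eq_twice:
  assumes "finite X" and f: "\<And>x. x \<in> X \<Longrightarrow> f x \<in> X" and ff: "\<And>x. x \<in> X \<Longrightarrow> f (f x) = x"
    and P: "\<And>x. x \<in> X \<Longrightarrow> P (f x) \<longleftrightarrow> \<not> P x"
  shows "card X = 2 * card {x \<in> X. P x}"
proof -
  have "bij_betw f {x \<in> X. P x} {x \<in> X. \<not> P x}"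
    by (rule bij_betw_byWitness[where f' = f]) (use f ff P in auto)
  then have "card {x \<in> X. \<not> P x} = card {x \<in> X. P x}"
    by (rule bij_betw_same_card[symmetric])
  moreover have "X = {x \<in> X. P x} \<union> {x \<in> X. \<not> P x}" by blast
  then have "card X = card {x \<in> X. P x} + card {x \<in> X. \<not> P x}"
    using card_Un_disjoint[of "{x \<in> X. P x}" "{x \<in> X. \<not> P x}"] \<open>finite X\<close> by auto
  ultimately show ?thesis by simp
qed

text \<open>\<open>f\<close> permutes \<open>X\<close>, so the three summands of the last hypothesis
  have equal sums over \<open>X\<close>, and each of these sums is the wanted cardinality.\<close>

lemma card_eq_thrice:
  assumes "finite X" and f: "\<And>x. x \<in> X \<Longrightarrow> f x \<in> X" and fff: "\<And>x. x \<in> X \<Longrightarrow> f (f (f x)) = x"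
    and P: "\<And>x. x \<in> X \<Longrightarrow> of_bool (P x) + of_bool (P (f x)) + of_bool (P (f (f x))) = (1::nat)"
  shows "card X = 3 * card {x \<in> X. P x}"
proof -
  have inj: "inj_on f X" using fff by (rule inj_on_inverseI)
  have surj: "f ` X = X"
  proof
    show "X \<subseteq> f ` X"
    proof
      fix x assume "x \<in> X"
      then have "f (f x) \<in> X" "f (f (f x)) = x" using f fff by auto
      then show "x \<in> f ` X" by (metis imageI)
    qed
  qed (use f in blast)
  have reindex: "(\<Sum>x\<in>X. g (f x)) = (\<Sum>x\<in>X. g x)" for g :: "'a \<Rightarrow> nat"
    using sum.reindex[OF inj, of g] surj by simp
  have c: "card {x \<in> X. P x} = (\<Sum>x\<in>X. of_bool (P x))"
    using \<open>finite X\<close> by (simp add: Collect_conj_eq)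
  have "card X = (\<Sum>x\<in>X. of_bool (P x) + of_bool (P (f x)) + of_bool (P (f (f x))))"
    using P by simp
  also have "\<dots> = (\<Sum>x\<in>X. of_bool (P x)) + (\<Sum>x\<in>X. of_bool (P (f x))) + (\<Sum>x\<in>X. of_bool (P (f (f x))))"
    by (simp add: sum.distrib)
  also have "\<dots> = 3 * (\<Sum>x\<in>X. of_bool (P x))"
    using reindex[of "\<lambda>x. of_bool (P x)"] reindex[of "\<lambda>x. of_bool (P (f x))"] by simp
  finally show ?thesis using c by simp
qed

section \<open>Squares as nine-tuples and their 72 symmetries\<close>

type_synonym entries = "int \<times> int \<times> int \<times> int \<times> int \<times> int \<times> int \<times> int \<times> int"

text \<open>Entries are listed row by row, so that permutations of rows and columns become plain
  tuple patterns without matrix indices.\<close>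

definition semimagic_entries :: "int \<Rightarrow> entries set" where
  "semimagic_entries s = {(a, b, c, d, e, f, g, h, i).
     distinct [a, b, c, d, e, f, g, h, i] \<and> (\<forall>z\<in>set [a, b, c, d, e, f, g, h, i]. 0 < z) \<and>
     a + b + c = s \<and> d + e + f = s \<and> g + h + i = s \<and>
     a + d + g = s \<and> b + e + h = s \<and> c + f + i = s}"

definition entries_of :: "int ^ 3 ^ 3 \<Rightarrow> entries" where
  "entries_of M = (vec_nth (vec_nth M 1) 1, vec_nth (vec_nth M 1) 2, vec_nth (vec_nth M 1) 3,
    vec_nth (vec_nth M 2) 1, vec_nth (vec_nth M 2) 2, vec_nth (vec_nth M 2) 3,
     vec_nth (vec_nth M 3) 1, vec_nth (vec_nth M 3) 2, vec_nth (vec_nth M 3) 3)"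

lemma inj_entries_of: "inj entries_of"
  by (rule injI) (simp add: entries_of_def vec_eq_iff forall_3)

lemma surj_entries_of: "surj entries_of"
proof (rule surjI)
  fix p :: entries
  show "entries_of (case p of (a, b, c, d, e, f, g, h, i) \<Rightarrow>
    vector [vector [a, b, c], vector [d, e, f], vector [g, h, i]]) = p"
    by (simp add: entries_of_def split: prod.split)
qed

lemma inj_3_3_iff:
  fixes M :: "'a ^ 3 ^ 3"
  shows "inj (\<lambda>(i, j). M $ i $ j) \<longleftrightarrow> distinct [vec_nth (vec_nth M 1) 1, vec_nth (vec_nth M 1) 2,
    vec_nth (vec_nth M 1) 3,
    vec_nth (vec_nth M 2) 1, vec_nth (vec_nth M 2) 2, vec_nth (vec_nth M 2) 3, vec_nth (vec_nth M
      3) 1, vec_nth (vec_nth M 3) 2, vec_nth (vec_nth M 3) 3]"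
proof -
  let ?l = "[(1, 1), (1, 2), (1, 3), (2, 1), (2, 2), (2, 3), (3, 1), (3, 2), (3, 3)] :: (3 \<times> 3)
    list"
  have "set ?l = UNIV" by (simp add: UNIV_3 flip: UNIV_Times_UNIV)
  moreover have "distinct ?l" by simp
  ultimately have "inj (\<lambda>(i, j). M $ i $ j) \<longleftrightarrow> distinct (map (\<lambda>(i, j). M $ i $ j) ?l)"
    by (metis distinct_map)
  then show ?thesis by simp
qed

lemma semimagic_square_iff_entries:
  "semimagic_square M s \<longleftrightarrow> entries_of M \<in> semimagic_entries s"
  unfolding semimagic_square_def inj_3_3_iff
  by (simp only: entries_of_def semimagic_entries_def forall_3 sum_3 mem_Collect_eq prod.case
    list.set ball_simps) argo

lemma card_entries: "card (semimagic_entries s) = card {M. semimagic_square M s}"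
  and finite_entries: "finite (semimagic_entries s)"
proof -
  have "bij_betw entries_of {M. semimagic_square M s} (semimagic_entries s)"
    unfolding bij_betw_def
  proof
    show "inj_on entries_of {M. semimagic_square M s}"
      using inj_entries_of by (rule inj_on_subset) simp
    show "entries_of ` {M. semimagic_square M s} = semimagic_entries s"
      using surj_image_vimage_eq[OF surj_entries_of, of "semimagic_entries s"]
      by (simp add: semimagic_square_iff_entries vimage_def)
  qed
  then show "card (semimagic_entries s) = card {M. semimagic_square M s}"
    "finite (semimagic_entries s)"
    using finite_semimagic_squares[of s] by (auto dest: bij_betw_same_card bij_betw_finite)
qed

text \<open>Written cyclically: the summands are what \<open>P x\<close>, \<open>P (f x)\<close>,
  \<open>P (f (f x))\<close> unfold to when \<open>f\<close> rotates rows or columns.\<close>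

lemma exactly_one_least:
  fixes x y z :: "'a :: linorder"
  assumes "x \<noteq> y" "y \<noteq> z" "x \<noteq> z"
  shows "of_bool (x < y \<and> x < z) + of_bool (y < z \<and> y < x) + of_bool (z < x \<and> z < y) = (1::nat)"
  using assms by (cases "x < y"; cases "y < z"; cases "x < z") auto

definition canonical_entries :: "int \<Rightarrow> entries set" where
  "canonical_entries s = {x \<in> semimagic_entries s. case x of (a, b, c, d, e, f, g, h, i) \<Rightarrow>
     (\<forall>z\<in>set [b, c, d, e, f, g, h, i]. a < z) \<and> b < c \<and> d < g \<and> b < d}"

text \<open>72 = 3 * 3 * 2 * 2 * 2: rotate rows until the least entry is in the first row, rotate
  columns until it is in the corner, order the rest of the first row, then the rest of the first
  column, and choose between the square and its transpose. Each symmetry preserves the set cut out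
  by the earlier conditions.\<close>

lemma card_semimagic_entries: "card (semimagic_entries s) = 72 * card (canonical_entries s)"
proof -
  define P1 :: "entries \<Rightarrow> bool" where "P1 = (\<lambda>(a, b, c, d, e, f, g, h, i).
    min a (min b c) < min d (min e f) \<and> min a (min b c) < min g (min h i))"
  define P2 :: "entries \<Rightarrow> bool" where "P2 = (\<lambda>(a, b, c, d, e, f, g, h, i). a < b \<and> a < c)"
  define P3 :: "entries \<Rightarrow> bool" where "P3 = (\<lambda>(a, b, c, d, e, f, g, h, i). b < c)"
  define P4 :: "entries \<Rightarrow> bool" where "P4 = (\<lambda>(a, b, c, d, e, f, g, h, i). d < g)"
  define P5 :: "entries \<Rightarrow> bool" where "P5 = (\<lambda>(a, b, c, d, e, f, g, h, i). b < d)"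
  define X0 where "X0 = semimagic_entries s"
  define X1 where "X1 = {x \<in> X0. P1 x}"
  define X2 where "X2 = {x \<in> X1. P2 x}"
  define X3 where "X3 = {x \<in> X2. P3 x}"
  define X4 where "X4 = {x \<in> X3. P4 x}"
  have fin: "finite X0" unfolding X0_def by (rule finite_entries)
  then have fin': "finite X1" "finite X2" "finite X3" "finite X4"
    by (simp_all add: X1_def X2_def X3_def X4_def)
  have X0: "(a, b, c, d, e, f, g, h, i) \<in> X0 \<longleftrightarrow>
     distinct [a, b, c, d, e, f, g, h, i] \<and> (\<forall>z\<in>set [a, b, c, d, e, f, g, h, i]. 0 < z) \<and>
     a + b + c = s \<and> d + e + f = s \<and> g + h + i = s \<and>
     a + d + g = s \<and> b + e + h = s \<and> c + f + i = s" for a b c d e f g h i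
    by (simp add: X0_def semimagic_entries_def)
  \<comment> \<open>Distinctness and positivity depend only on the multiset of entries, so
    invariance under the five symmetries reduces to multiset equalities and permuted line
    sums.\<close>
  define ok :: "int multiset \<Rightarrow> bool" where "ok M \<longleftrightarrow> (\<forall>z\<in>#M. count M z = 1 \<and> 0 < z)" for M
  have "distinct l \<and> (\<forall>z\<in>set l. 0 < z) \<longleftrightarrow> ok (mset l)" for l
    unfolding ok_def distinct_count_atmost_1 by (auto simp: count_eq_zero_iff)
  then have X0_ok: "(a, b, c, d, e, f, g, h, i) \<in> X0 \<longleftrightarrow> ok {#a, b, c, d, e, f, g, h, i#} \<and>
     a + b + c = s \<and> d + e + f = s \<and> g + h + i = s \<and>
     a + d + g = s \<and> b + e + h = s \<and> c + f + i = s" for a b c d e f g h i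
    unfolding X0 by (metis mset.simps)
  have distinct: "distinct [a, b, c, d, e, f, g, h, i]" if "(a, b, c, d, e, f, g, h, i) \<in> X0"
    for a b c d e f g h i using that X0 by blast
  then have ne: "b \<noteq> c" "d \<noteq> g" "b \<noteq> d" if "(a, b, c, d, e, f, g, h, i) \<in> X0" for a b c d e f g h i
    using that by fastforce+
  have perm: "(d, e, f, g, h, i, a, b, c) \<in> X0"
    "(b, c, a, e, f, d, h, i, g) \<in> X0"
    "(a, c, b, d, f, e, g, i, h) \<in> X0"
    "(a, b, c, g, h, i, d, e, f) \<in> X0"
    "(a, d, g, b, e, h, c, f, i) \<in> X0"
    if "(a, b, c, d, e, f, g, h, i) \<in> X0" for a b c d e f g h i
  proof -
    have ms: "{#d, e, f, g, h, i, a, b, c#} = {#a, b, c, d, e, f, g, h, i#}"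
      "{#b, c, a, e, f, d, h, i, g#} = {#a, b, c, d, e, f, g, h, i#}"
      "{#a, c, b, d, f, e, g, i, h#} = {#a, b, c, d, e, f, g, h, i#}"
      "{#a, b, c, g, h, i, d, e, f#} = {#a, b, c, d, e, f, g, h, i#}"
      "{#a, d, g, b, e, h, c, f, i#} = {#a, b, c, d, e, f, g, h, i#}"
      by (simp_all add: add_mset_commute)
    show "(d, e, f, g, h, i, a, b, c) \<in> X0"
      "(b, c, a, e, f, d, h, i, g) \<in> X0"
      "(a, c, b, d, f, e, g, i, h) \<in> X0"
      "(a, b, c, g, h, i, d, e, f) \<in> X0"
      "(a, d, g, b, e, h, c, f, i) \<in> X0"
      using that unfolding X0_ok ms by (simp_all add: add_ac)
  qed
  \<comment> \<open>After both rotations the corner is the least of all nine entries, a condition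
    invariant under the three remaining symmetries, which fix the corner.\<close>
  have X2: "(a, b, c, d, e, f, g, h, i) \<in> X2 \<longleftrightarrow> (a, b, c, d, e, f, g, h, i) \<in> X0 \<and>
     (\<forall>z\<in>set [b, c, d, e, f, g, h, i]. a < z)" for a b c d e f g h i
    by (auto simp: X2_def X1_def P1_def P2_def)
  have "card X0 = 3 * card X1"
    unfolding X1_def
  proof (rule card_eq_thrice[where f = "\<lambda>(a, b, c, d, e, f, g, h, i). (d, e, f, g, h, i, a, b, c)"])
    fix x assume xX: "x \<in> X0"
    obtain a b c d e f g h i where x: "x = (a, b, c, d, e, f, g, h, i)" by (metis surj_pair)
    have "min a (min b c) \<in> {a, b, c}" "min d (min e f) \<in> {d, e, f}" "min g (min h i) \<in> {g, h, i}"
      by (auto simp: min_def)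
    moreover have "{a, b, c} \<inter> {d, e, f} = {}" "{d, e, f} \<inter> {g, h, i} = {}" "{a, b, c} \<inter> {g, h, i}
      = {}"
      using distinct[of a b c d e f g h i] xX x by auto
    ultimately have "min a (min b c) \<noteq> min d (min e f)" "min d (min e f) \<noteq> min g (min h i)"
      "min a (min b c) \<noteq> min g (min h i)"
      by (metis IntI empty_iff, metis IntI empty_iff, metis IntI empty_iff)
    from exactly_one_least[OF this]
    show "of_bool (P1 x) + of_bool (P1 (case x of (a, b, c, d, e, f, g, h, i) \<Rightarrow> (d, e, f, g, h, i,
      a, b, c)))
      + of_bool (P1 (case (case x of (a, b, c, d, e, f, g, h, i) \<Rightarrow> (d, e, f, g, h, i, a, b, c)) of
         (a, b, c, d, e, f, g, h, i) \<Rightarrow> (d, e, f, g, h, i, a, b, c))) = (1::nat)"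
      by (simp only: P1_def prod.case x)
  qed (use fin perm(1) in auto)
  moreover have "card X1 = 3 * card X2"
    unfolding X2_def
  proof (rule card_eq_thrice[where f = "\<lambda>(a, b, c, d, e, f, g, h, i). (b, c, a, e, f, d, h, i, g)"])
    fix x assume xX: "x \<in> X1"
    obtain a b c d e f g h i where x: "x = (a, b, c, d, e, f, g, h, i)" by (metis surj_pair)
    have "a \<noteq> b" "b \<noteq> c" "a \<noteq> c"
      using distinct[of a b c d e f g h i] xX x by (auto simp: X1_def)
    from exactly_one_least[OF this]
    show "of_bool (P2 x) + of_bool (P2 (case x of (a, b, c, d, e, f, g, h, i) \<Rightarrow> (b, c, a, e, f, d,
      h, i, g)))
      + of_bool (P2 (case (case x of (a, b, c, d, e, f, g, h, i) \<Rightarrow> (b, c, a, e, f, d, h, i, g)) of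
         (a, b, c, d, e, f, g, h, i) \<Rightarrow> (b, c, a, e, f, d, h, i, g))) = (1::nat)"
      by (simp only: P2_def prod.case x)
    \<comment> \<open>Rotating the columns permutes each row cyclically, so the row minima, and with
      them \<open>P1\<close>, do not change.\<close>
    have rot: "min q (min r p) = min p (min q r)" for p q r :: int by (simp add: ac_simps)
    show "(case x of (a, b, c, d, e, f, g, h, i) \<Rightarrow> (b, c, a, e, f, d, h, i, g)) \<in> X1"
      using xX perm(2)[of a b c d e f g h i] unfolding X1_def P1_def mem_Collect_eq x prod.case
        rot by blast
  qed (use fin' in auto)
  moreover have "card X2 = 2 * card X3"
    unfolding X3_def
  proof (rule card_eq_twice[where f = "\<lambda>(a, b, c, d, e, f, g, h, i). (a, c, b, d, f, e, g, i, h)"])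
    fix x assume xX: "x \<in> X2"
    obtain a b c d e f g h i where x: "x = (a, b, c, d, e, f, g, h, i)" by (metis surj_pair)
    show "P3 (case x of (a, b, c, d, e, f, g, h, i) \<Rightarrow> (a, c, b, d, f, e, g, i, h)) \<longleftrightarrow> \<not> P3 x"
      using xX ne(1)[of a b c d e f g h i] by (auto simp: x X2 P3_def)
  qed (use fin' in \<open>auto simp: X2 P3_def intro: perm(3)\<close>)
  moreover have "card X3 = 2 * card X4"
    unfolding X4_def
  proof (rule card_eq_twice[where f = "\<lambda>(a, b, c, d, e, f, g, h, i). (a, b, c, g, h, i, d, e, f)"])
    fix x assume xX: "x \<in> X3"
    obtain a b c d e f g h i where x: "x = (a, b, c, d, e, f, g, h, i)" by (metis surj_pair)
    show "P4 (case x of (a, b, c, d, e, f, g, h, i) \<Rightarrow> (a, b, c, g, h, i, d, e, f)) \<longleftrightarrow> \<not> P4 x"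
      using xX ne(2)[of a b c d e f g h i] by (auto simp: x X2 X3_def P3_def P4_def)
  qed (use fin' in \<open>auto simp: X2 X3_def P3_def P4_def intro: perm(4)\<close>)
  moreover have "card X4 = 2 * card {x \<in> X4. P5 x}"
  proof (rule card_eq_twice[where f = "\<lambda>(a, b, c, d, e, f, g, h, i). (a, d, g, b, e, h, c, f, i)"])
    fix x assume xX: "x \<in> X4"
    obtain a b c d e f g h i where x: "x = (a, b, c, d, e, f, g, h, i)" by (metis surj_pair)
    show "P5 (case x of (a, b, c, d, e, f, g, h, i) \<Rightarrow> (a, d, g, b, e, h, c, f, i)) \<longleftrightarrow> \<not> P5 x"
      using xX ne(3)[of a b c d e f g h i] by (auto simp: x X2 X4_def X3_def P3_def P4_def P5_def)
  qed (use fin' in \<open>auto simp: X2 X4_def X3_def P3_def P4_def P5_def intro: perm(5)\<close>)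
  moreover have "{x \<in> X4. P5 x} = canonical_entries s"
    by (auto simp: canonical_entries_def X4_def X3_def X2 P3_def P4_def P5_def X0_def)
  ultimately show ?thesis unfolding X0_def by simp
qed

section \<open>Parametrization of the canonical squares\<close>

abbreviation generic :: "'a :: plus \<Rightarrow> 'a \<Rightarrow> 'a \<Rightarrow> 'a \<Rightarrow> bool" where
  "generic x y u v \<equiv> x \<noteq> y \<and> y \<noteq> x + u \<and> x \<noteq> y + u + v \<and> y \<noteq> u \<and>
     x \<noteq> u + v \<and> x \<noteq> y + v \<and> x \<noteq> v"

type_synonym params = "nat \<times> nat \<times> nat \<times> nat \<times> nat"

definition generic_params :: "params set" where
  "generic_params = {(m, x, y, u, v). 0 < m \<and> 0 < x \<and> 0 < y \<and> 0 < u \<and> 0 < v \<and>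
     generic x y u v}"

text \<open>Bracketed as a multiple of the first coordinate plus the weight of the rest, the shape
  on which \<open>gf_Times\<close> works.\<close>

fun params_sum :: "params \<Rightarrow> nat" where
  "params_sum (m, x, y, u, v) = 3 * m + (2 * x + (2 * y + (2 * u + v)))"

text \<open>Of the 36 differences between entries, 29 have a fixed sign for positive parameters; the
  other seven vanish exactly on the seven hyperplanes.\<close>

lemma distinct_parametrization:
  fixes m x y u v :: int
  assumes "0 < x" "0 < y" "0 < u" "0 < v"
  shows "distinct [m, m + x + y, m + x + y + 2 * u + v, m + x + y + u, m + y + u + v, m + x,
      m + x + y + u + v, m + x + u, m + y] \<longleftrightarrow>
    generic x y u v"
    (is "distinct ?l \<longleftrightarrow> ?r")
proof
  assume "distinct ?l"
  then show ?r by auto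
next
  assume ?r
  then show "distinct ?l"
    unfolding distinct.simps list.set
    using assms by auto
qed

lemma canonical_entries_iff:
  "q \<in> canonical_entries s \<longleftrightarrow> (\<exists>m x y u v. 0 < m \<and> 0 < x \<and> 0 < y \<and> 0 < u \<and> 0 < v \<and>
     generic x y u v \<and>
     3 * m + (2 * x + (2 * y + (2 * u + v))) = s \<and>
     q = (m, m + x + y, m + x + y + 2 * u + v, m + x + y + u, m + y + u + v, m + x,
      m + x + y + u + v, m + x + u, m + y))"
    (is "_ \<longleftrightarrow> ?r")
proof
  assume q: "q \<in> canonical_entries s"
  obtain a b c d e f g h i where q_eq: "q = (a, b, c, d, e, f, g, h, i)" by (metis surj_pair)
  have dist: "distinct [a, b, c, d, e, f, g, h, i]"
    and eqn: "a + b + c = s" "d + e + f = s" "g + h + i = s" "a + d + g = s" "b + e + h = s"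
      "c + f + i = s" and less: "0 < a" "a < b" "a < c" "a < d" "a < e" "a < f" "a < g" "a < h" "a
        < i" "b < c" "d < g" "b < d"
    using q by (simp_all add: q_eq canonical_entries_def semimagic_entries_def)
  \<comment> \<open>\<open>m\<close>, \<open>x\<close>, \<open>y\<close> are positive because the
    corner is the least entry and positive, \<open>u\<close> because \<open>b < d\<close>,
    \<open>v\<close> because \<open>d < g\<close>. The line sums determine the other entries, for
    instance \<open>b = f + i - a\<close>.\<close>
  define m x y u v where "m = a" and "x = f - a" and "y = i - a" and "u = d - b" and "v = g - d"
  note params = this
  have eqs: "a = m" "b = m + x + y" "c = m + x + y + 2 * u + v" "d = m + x + y + u"
    "e = m + y + u + v" "f = m + x" "g = m + x + y + u + v" "h = m + x + u" "i = m + y"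
    using eqn by (simp_all add: params)
  have pos: "0 < m" "0 < x" "0 < y" "0 < u" "0 < v" using less by (simp_all add: params)
  have "3 * m + (2 * x + (2 * y + (2 * u + v))) = s" using eqn by (simp add: params)
  moreover have "q = (m, m + x + y, m + x + y + 2 * u + v, m + x + y + u, m + y + u + v, m + x,
      m + x + y + u + v, m + x + u, m + y)"
    by (simp only: q_eq eqs)
  moreover note dist[unfolded eqs distinct_parametrization[OF pos(2-5)]]
  ultimately show ?r using pos by blast
next
  assume ?r
  then obtain m x y u v where pos: "0 < m" "0 < x" "0 < y" "0 < u" "0 < v"
    and ne: "generic x y u v"
    and s: "3 * m + (2 * x + (2 * y + (2 * u + v))) = s"
    and q: "q = (m, m + x + y, m + x + y + 2 * u + v, m + x + y + u, m + y + u + v, m + x,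
      m + x + y + u + v, m + x + u, m + y)" by blast
  have "distinct [m, m + x + y, m + x + y + 2 * u + v, m + x + y + u, m + y + u + v, m + x,
      m + x + y + u + v, m + x + u, m + y]"
    using ne distinct_parametrization[OF pos(2-5)] by blast
  then show "q \<in> canonical_entries s"
    unfolding q canonical_entries_def semimagic_entries_def mem_Collect_eq prod.case list.set
      ball_simps
    using pos s by (intro conjI TrueI) (assumption | linarith)+
qed

text \<open>\<open>generic\<close> involves sums only, no differences, so it transfers between
  positive integers and natural numbers.\<close>

lemma card_canonical_entries:
  "card (canonical_entries (int t)) = card {p \<in> generic_params. params_sum p = t}"
proof -
  define \<phi> :: "params \<Rightarrow> entries" where "\<phi> = (\<lambda>(m, x, y, u, v).
    (int m, int m + int x + int y, int m + int x + int y + 2 * int u + int v,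
     int m + int x + int y + int u, int m + int y + int u + int v, int m + int x,
     int m + int x + int y + int u + int v, int m + int x + int u, int m + int y))"
  have "inj_on \<phi> {p \<in> generic_params. params_sum p = t}"
    by (rule inj_onI) (clarsimp simp: \<phi>_def)
  moreover have "\<phi> ` {p \<in> generic_params. params_sum p = t} = canonical_entries (int t)"
  proof (intro set_eqI iffI)
    fix q assume "q \<in> \<phi> ` {p \<in> generic_params. params_sum p = t}"
    then obtain m x y u v where "(m, x, y, u, v) \<in> generic_params" and t: "params_sum (m, x, y, u,
      v) = t"
      and "q = \<phi> (m, x, y, u, v)" by auto
    then have pos: "0 < m" "0 < x" "0 < y" "0 < u" "0 < v"
      and ne: "generic x y u v"
      and q: "q = \<phi> (m, x, y, u, v)" by (simp_all add: generic_params_def)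
    have "0 < int m" "0 < int x" "0 < int y" "0 < int u" "0 < int v" using pos by simp_all
    moreover have "generic (int x) (int y) (int u) (int v)"
      using ne by (simp only: of_nat_add[symmetric] of_nat_eq_iff not_False_eq_True simp_thms)
    moreover have "3 * int m + (2 * int x + (2 * int y + (2 * int u + int v))) = int t"
      using t by simp
    ultimately show "q \<in> canonical_entries (int t)"
      unfolding canonical_entries_iff q \<phi>_def prod.case by blast
  next
    fix q assume "q \<in> canonical_entries (int t)"
    then obtain m' x' y' u' v' where pos': "0 < m'" "0 < x'" "0 < y'" "0 < u'" "0 < v'"
      and ne': "generic x' y' u' v'"
      and s': "3 * m' + (2 * x' + (2 * y' + (2 * u' + v'))) = int t"
      and q': "q = (m', m' + x' + y', m' + x' + y' + 2 * u' + v', m' + x' + y' + u', m' + y' + u'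
        + v',
        m' + x', m' + x' + y' + u' + v', m' + x' + u', m' + y')"
      unfolding canonical_entries_iff by blast
    from pos' obtain m x y u v where eqs: "m' = int m" "x' = int x" "y' = int y" "u' = int u" "v'
      = int v"
      by (metis zero_less_imp_eq_int)
    have "0 < m" "0 < x" "0 < y" "0 < u" "0 < v" using pos' by (simp_all add: eqs)
    moreover have "generic x y u v"
      using ne' by (simp only: eqs of_nat_add[symmetric] of_nat_eq_iff not_False_eq_True simp_thms)
    ultimately have "(m, x, y, u, v) \<in> generic_params" by (simp add: generic_params_def)
    moreover have "params_sum (m, x, y, u, v) = t" using s' by (simp add: eqs)
    moreover have "q = \<phi> (m, x, y, u, v)" by (simp only: q' eqs \<phi>_def prod.case)
    ultimately show "q \<in> \<phi> ` {p \<in> generic_params. params_sum p = t}" by blast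
  qed
  ultimately have "bij_betw \<phi> {p \<in> generic_params. params_sum p = t} (canonical_entries (int t))"
    by (simp add: bij_betw_def)
  then show ?thesis by (rule bij_betw_same_card[symmetric])
qed

lemma Sa_eq_card_params: "Sa t = 72 * card {p \<in> generic_params. params_sum p = t}"
  unfolding Sa_def card_entries[symmetric] card_semimagic_entries card_canonical_entries ..

section \<open>Generating functions of weighted lattice points\<close>

definition gf :: "('a \<Rightarrow> nat) \<Rightarrow> 'a set \<Rightarrow> real fps" where
  "gf w A = Abs_fps (\<lambda>n. real (card {p \<in> A. w p = n}))"

text \<open>Guards against the value 0 of \<open>card\<close> on infinite sets, so that coefficients
  of \<open>gf\<close> are genuine counts.\<close>

definition finite_fibres :: "('a \<Rightarrow> nat) \<Rightarrow> 'a set \<Rightarrow> bool" where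
  "finite_fibres w A \<longleftrightarrow> (\<forall>n. finite {p \<in> A. w p = n})"

text \<open>The series \<open>X^a + X^(2a) + ...\<close> of the positive multiples of
  \<open>a\<close>.\<close>

definition geo :: "nat \<Rightarrow> real fps" where
  "geo a = fps_X ^ a * inverse (1 - fps_X ^ a)"

lemma geo_mult: "a > 0 \<Longrightarrow> geo a * (1 - fps_X ^ a) = fps_X ^ a"
  by (simp add: geo_def mult.assoc inverse_mult_eq_1)

lemma eq_geo_multI:
  fixes F G :: "real fps"
  assumes "a > 0" and "F * (1 - fps_X ^ a) = fps_X ^ a * G"
  shows "F = geo a * G"
proof -
  have "F * (1 - fps_X ^ a) * inverse (1 - fps_X ^ a) = fps_X ^ a * G * inverse (1 - fps_X ^ a)"
    using assms(2) by simp
  then show ?thesis using \<open>a > 0\<close> by (simp add: geo_def mult_ac inverse_mult_eq_1')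
qed

lemma finite_fibres_subset: "finite_fibres w A \<Longrightarrow> B \<subseteq> A \<Longrightarrow> finite_fibres w B"
  unfolding finite_fibres_def
proof
  fix n assume fin: "\<forall>n. finite {p \<in> A. w p = n}" and "B \<subseteq> A"
  have "{p \<in> B. w p = n} \<subseteq> {p \<in> A. w p = n}" using \<open>B \<subseteq> A\<close> by blast
  then show "finite {p \<in> B. w p = n}" using fin finite_subset by auto
qed

lemma finite_fibres_linear: "a > 0 \<Longrightarrow> finite_fibres (\<lambda>k. a * k) A"
  unfolding finite_fibres_def
proof
  fix n assume "a > 0"
  then have "{p \<in> A. a * p = n} \<subseteq> {..n}" by auto
  then show "finite {p \<in> A. a * p = n}" using finite_subset by blast
qed

lemma finite_fibres_Times:
  assumes "a > 0" "finite_fibres w A"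
  shows "finite_fibres (\<lambda>(k, p). a * k + w p) (B \<times> A)"
  unfolding finite_fibres_def
proof
  fix n
  have le: "k \<le> a * k" for k using \<open>a > 0\<close> by (cases a) auto
  have "{q \<in> B \<times> A. (case q of (k, p) \<Rightarrow> a * k + w p) = n} \<subseteq> {..n} \<times> (\<Union>i\<le>n. {p \<in> A. w p = i})"
    by (auto intro!: trans_le_add1 le)
  moreover have "finite ({..n} \<times> (\<Union>i\<le>n. {p \<in> A. w p = i}))"
    using assms(2) by (auto simp: finite_fibres_def)
  ultimately show "finite {q \<in> B \<times> A. (case q of (k, p) \<Rightarrow> a * k + w p) = n}"
    using finite_subset by blast
qed

text \<open>Lowering the first coordinate by one lowers the weight by \<open>a\<close>. This matches
  the points with \<open>k > 1\<close> with all points, and leaves those with \<open>k = 1\<close>,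
  a copy of \<open>A\<close> shifted by \<open>a\<close>; hence
  \<open>F * (1 - X^a) = X^a * G\<close>.\<close>

lemma gf_Times:
  assumes a: "a > 0" and fin: "finite_fibres w A"
  shows "gf (\<lambda>(k, p). a * k + w p) ({0<..} \<times> A) = geo a * gf w A"
proof (rule eq_geo_multI[OF a], rule fps_ext)
  fix n
  let ?W = "\<lambda>(k, p). a * k + w p"
  let ?S = "\<lambda>n. {q \<in> {0<..} \<times> A. ?W q = n}"
  have finS: "finite (?S n)" for n
    using finite_fibres_Times[OF a fin, of "{0<..}"] by (simp add: finite_fibres_def)
  have nth: "fps_nth (gf ?W ({0<..} \<times> A)) m = real (card (?S m))" for m by (simp add: gf_def)
  have "gf ?W ({0<..} \<times> A) * (1 - fps_X ^ a) = gf ?W ({0<..} \<times> A) - fps_X ^ a * gf ?W ({0<..} \<times> A)"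
    by (simp add: algebra_simps)
  note diff = arg_cong[OF this, of "\<lambda>F. fps_nth F n", unfolded fps_sub_nth fps_X_power_mult_nth nth]
  show "fps_nth (gf ?W ({0<..} \<times> A) * (1 - fps_X ^ a)) n = fps_nth (fps_X ^ a * gf w A) n"
  proof (cases "n < a")
    case True
    then have "a * k + w p \<noteq> n" if "0 < k" for k p using that by (cases k) auto
    then have "card (?S n) = 0" by (intro card_eq_0_iff[THEN iffD2]) auto
    with True show ?thesis unfolding diff by (simp only: fps_X_power_mult_nth) simp
  next
    case False
    let ?f = "\<lambda>(k, p). (Suc k, p)" and ?g = "\<lambda>p. (Suc 0, p)"
    \<comment> \<open>\<open>?f\<close> supplies the points with first coordinate at least 2,
      \<open>?g\<close> those with first coordinate 1.\<close>
    have "?S n = ?f ` ?S (n - a) \<union> ?g ` {p \<in> A. w p = n - a}"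
    proof (intro set_eqI iffI)
      fix q assume "q \<in> ?S n"
      then obtain k p where q: "q = (Suc k, p)" "p \<in> A" "a * Suc k + w p = n"
        by (cases q) (auto simp: gr0_conv_Suc)
      show "q \<in> ?f ` ?S (n - a) \<union> ?g ` {p \<in> A. w p = n - a}"
      proof (cases "k = 0")
        case True then show ?thesis using q by auto
      next
        case False
        then have "(k, p) \<in> ?S (n - a)" using q by auto
        moreover have "q = ?f (k, p)" using q by simp
        ultimately show ?thesis by blast
      qed
    next
      fix q assume "q \<in> ?f ` ?S (n - a) \<union> ?g ` {p \<in> A. w p = n - a}"
      then show "q \<in> ?S n" using False by auto
    qed
    moreover have "?f ` ?S (n - a) \<inter> ?g ` {p \<in> A. w p = n - a} = {}" by auto
    moreover have "finite {p \<in> A. w p = n - a}" using fin by (simp add: finite_fibres_def)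
    ultimately have "card (?S n) = card (?f ` ?S (n - a)) + card (?g ` {p \<in> A. w p = n - a})"
      using finS[of "n - a"] by (simp add: card_Un_disjoint)
    also have "\<dots> = card (?S (n - a)) + card {p \<in> A. w p = n - a}"
      by (simp add: card_image inj_on_def)
    finally show ?thesis using False unfolding diff by (simp add: fps_X_power_mult_nth gf_def)
  qed
qed

lemma gf_linear: "a > 0 \<Longrightarrow> gf (\<lambda>k. a * k) {0<..} = geo a"
proof -
  assume a: "a > 0"
  \<comment> \<open>A one-point second factor of weight 0 turns the claim into an instance of
    \<open>gf_Times\<close>.\<close>
  have "gf (\<lambda>k. a * k) {0<..} = gf (\<lambda>(k, p). a * k + 0) ({0<..} \<times> {()})"
  proof -
    have "card {p \<in> {0<..}. a * p = n} = card {q \<in> {0<..} \<times> {()}. (\<lambda>(k, p). a * k + 0) q = n}" for n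
      by (rule bij_betw_same_card[of "\<lambda>k. (k, ())"]) (auto simp: bij_betw_def inj_on_def)
    then show ?thesis by (simp add: gf_def)
  qed
  also have "\<dots> = geo a * gf (\<lambda>p. 0) {()}"
    by (rule gf_Times[OF a]) (simp add: finite_fibres_def)
  also have "gf (\<lambda>p. 0) {()} = 1"
    by (rule fps_ext) (simp add: gf_def)
  finally show ?thesis by simp
qed

lemma gf_image:
  assumes "inj_on \<phi> B" "\<phi> ` B = A" "\<And>p. p \<in> B \<Longrightarrow> w (\<phi> p) = w' p"
  shows "gf w A = gf w' B"
proof -
  have "bij_betw \<phi> {p \<in> B. w' p = n} {p \<in> A. w p = n}" for n
    using assms by (auto simp: bij_betw_def inj_on_def)
  from bij_betw_same_card[OF this] show ?thesis by (simp add: gf_def)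
qed

text \<open>Coefficients become sums of indicators over a fibre that does not depend on
  \<open>Q\<close>, so pointwise identities between indicators lift to series.\<close>

lemma gf_nth_of_bool:
  assumes "finite_fibres w P"
  shows "fps_nth (gf w {p \<in> P. Q p}) n = (\<Sum>p\<in>{p \<in> P. w p = n}. of_bool (Q p))"
proof -
  have "{p \<in> {p \<in> P. Q p}. w p = n} = {p \<in> P. w p = n} \<inter> {p. Q p}" by blast
  then show ?thesis using assms by (simp add: gf_def finite_fibres_def)
qed

section \<open>Orthants, and inclusion-exclusion over the flats\<close>

abbreviation pos2 :: "(nat \<times> nat) set" where "pos2 \<equiv> {0<..} \<times> {0<..}"
abbreviation pos3 :: "(nat \<times> nat \<times> nat) set" where "pos3 \<equiv> {0<..} \<times> pos2"
abbreviation pos4 :: "(nat \<times> nat \<times> nat \<times> nat) set" where "pos4 \<equiv> {0<..} \<times> pos3"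

lemma gf_pos2:
  assumes "a > 0" "b > 0"
  shows "gf (\<lambda>(k, l). a * k + b * l) pos2 = geo a * geo b"
    and "finite_fibres (\<lambda>(k, l). a * k + b * l) pos2"
  using gf_Times[OF assms(1) finite_fibres_linear[OF assms(2)]] assms(2)
    finite_fibres_Times[OF assms(1) finite_fibres_linear[OF assms(2)]] by (simp_all add: gf_linear)

lemma gf_pos3:
  assumes "a > 0" "b > 0" "c > 0"
  shows "gf (\<lambda>(j, k, l). a * j + (b * k + c * l)) pos3 = geo a * geo b * geo c"
    and "finite_fibres (\<lambda>(j, k, l). a * j + (b * k + c * l)) pos3"
  using gf_Times[OF assms(1) gf_pos2(2)[OF assms(2,3)]]
    finite_fibres_Times[OF assms(1) gf_pos2(2)[OF assms(2,3)]] gf_pos2(1)[OF assms(2,3)]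
  by (simp_all add: mult.assoc case_prod_unfold)

lemma gf_pos4:
  assumes "a > 0" "b > 0" "c > 0" "d > 0"
  shows "gf (\<lambda>(i, j, k, l). a * i + (b * j + (c * k + d * l))) pos4 = geo a * geo b * geo c * geo d"
    and "finite_fibres (\<lambda>(i, j, k, l). a * i + (b * j + (c * k + d * l))) pos4"
  using gf_Times[OF assms(1) gf_pos3(2)[OF assms(2-4)]]
    finite_fibres_Times[OF assms(1) gf_pos3(2)[OF assms(2-4)]] gf_pos3(1)[OF assms(2-4)]
  by (simp_all add: mult.assoc case_prod_unfold)

text \<open>The coefficients are the Moebius values of the flats that meet the open orthant. The 2
  belongs to the flat where three hyperplanes \<open>x = u + v\<close>, \<open>y = u\<close>,
  \<open>x = y + v\<close> meet; on every other flat of codimension two only two meet.\<close>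

lemma of_bool_generic:
  fixes x y u v :: nat
  assumes "0 < x" "0 < y" "0 < u" "0 < v"
  shows "(of_bool (generic x y u v) :: real) =
    1
      - of_bool (x = y + u + v)
      - of_bool (x = y + v)
      - of_bool (y = x + u)
      - of_bool (x = u + v)
      + of_bool (x = u + v \<and> y = u + u + v)
      + 2 * of_bool (x = u + v \<and> y = u)
      - of_bool (x = v)
      + of_bool (x = v \<and> y = u + v)
      - of_bool (y = u)
      + of_bool (y = u \<and> x = u + u + v)
      + of_bool (y = u \<and> x = v)
      - of_bool (x = y)
      + of_bool (x = y \<and> y = u + v)
      + of_bool (x = y \<and> y = v)
      + of_bool (x = y \<and> y = u)
      - of_bool (x = y \<and> y = u \<and> u = v)"
proof (cases "x = y")
  case True
  show ?thesis
    using assms unfolding True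
    by (cases "y = u"; cases "u = v"; cases "y = v"; cases "y = u + v"; simp only:; simp)
next
  case ne: False
  show ?thesis
  proof (cases "y = u")
    case True
    show ?thesis
      using assms ne unfolding True
      by (cases "x = v"; cases "x = u + v"; cases "x = u + u + v"; simp)
  next
    case ne': False
    show ?thesis
    proof (cases "x = v")
      case True
      show ?thesis
        using assms ne ne' unfolding True
        by (cases "y = u + v"; cases "y = v + u"; simp)
    next
      case False
      then show ?thesis
      proof (cases "x = u + v")
        case True
        show ?thesis
          using assms ne ne' False unfolding True
          by (cases "y = u + u + v"; simp)
      next
        \<comment> \<open>Only \<open>x = y + u + v\<close>, \<open>x = y + v\<close> and
          \<open>y = x + u\<close> are left, and they exclude each other for positive
          values.\<close>
        case ne'': False
        then show ?thesis using assms ne ne' False by simp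
      qed
    qed
  qed
qed

text \<open>The share of the magic sum above \<open>3 * m\<close>; the least entry \<open>m\<close>
  contributes the separate factor \<open>geo 3\<close>.\<close>

definition wt :: "nat \<times> nat \<times> nat \<times> nat \<Rightarrow> nat" where
  "wt = (\<lambda>(x, y, u, v). 2 * x + (2 * y + (2 * u + v)))"

definition flat :: "(nat \<Rightarrow> nat \<Rightarrow> nat \<Rightarrow> nat \<Rightarrow> bool) \<Rightarrow> real fps" where
  "flat Q = gf wt {p \<in> pos4. case p of (x, y, u, v) \<Rightarrow> Q x y u v}"

lemma finite_fibres_wt: "finite_fibres wt pos4"
  using gf_pos4(2)[of 2 2 2 1] by (simp add: wt_def)

lemma fps_nth_numeral_mult: "fps_nth (numeral k * F) n = numeral k * fps_nth (F :: real fps) n"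
  by (simp add: fps_numeral_fps_const)

lemma flat_nth: "fps_nth (flat Q) n =
    (\<Sum>p\<in>{p \<in> pos4. wt p = n}. of_bool (case p of (x, y, u, v) \<Rightarrow> Q x y u v))"
  unfolding flat_def by (rule gf_nth_of_bool[OF finite_fibres_wt])

text \<open>\<open>of_bool_generic\<close> summed over each finite fibre of
  \<open>wt\<close>.\<close>

lemma flat_generic:
  "flat (\<lambda>x y u v. generic x y u v) =
    flat (\<lambda>x y u v. True)
      - flat (\<lambda>x y u v. x = y + u + v)
      - flat (\<lambda>x y u v. x = y + v)
      - flat (\<lambda>x y u v. y = x + u)
      - flat (\<lambda>x y u v. x = u + v)
      + flat (\<lambda>x y u v. x = u + v \<and> y = u + u + v)
      + 2 * flat (\<lambda>x y u v. x = u + v \<and> y = u)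
      - flat (\<lambda>x y u v. x = v)
      + flat (\<lambda>x y u v. x = v \<and> y = u + v)
      - flat (\<lambda>x y u v. y = u)
      + flat (\<lambda>x y u v. y = u \<and> x = u + u + v)
      + flat (\<lambda>x y u v. y = u \<and> x = v)
      - flat (\<lambda>x y u v. x = y)
      + flat (\<lambda>x y u v. x = y \<and> y = u + v)
      + flat (\<lambda>x y u v. x = y \<and> y = v)
      + flat (\<lambda>x y u v. x = y \<and> y = u)
      - flat (\<lambda>x y u v. x = y \<and> y = u \<and> u = v)"
    (is "?l = ?r")
proof (rule fps_ext)
  fix n
  show "fps_nth ?l n = fps_nth ?r n"
    unfolding fps_add_nth fps_sub_nth fps_nth_numeral_mult flat_nth sum_distrib_left
      sum.distrib[symmetric] sum_subtractf[symmetric]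
    by (rule sum.cong[OF refl])
      (clarsimp simp only: mem_Collect_eq mem_Sigma_iff greaterThan_iff prod.case of_bool_generic
        of_bool_eq)
qed

text \<open>Substituting the dependent variables makes the weight linear in the free ones, whose
  coefficients are the arguments of \<open>geo\<close>: on \<open>x = y + u + v\<close> it is
  \<open>4 * y + 4 * u + 3 * v\<close>. The dependent variables, being sums, are positive
  automatically.\<close>

lemma flat_eqs:
  "flat (\<lambda>x y u v. True) = geo 2 * geo 2 * geo 2 * geo 1"
  "flat (\<lambda>x y u v. x = y + u + v) = geo 4 * geo 4 * geo 3"
  "flat (\<lambda>x y u v. x = y + v) = geo 4 * geo 2 * geo 3"
  "flat (\<lambda>x y u v. y = x + u) = geo 4 * geo 4 * geo 1"
  "flat (\<lambda>x y u v. x = u + v) = geo 2 * geo 4 * geo 3"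
  "flat (\<lambda>x y u v. x = u + v \<and> y = u + u + v) = geo 8 * geo 5"
  "flat (\<lambda>x y u v. x = u + v \<and> y = u) = geo 6 * geo 3"
  "flat (\<lambda>x y u v. x = v) = geo 2 * geo 2 * geo 3"
  "flat (\<lambda>x y u v. x = v \<and> y = u + v) = geo 4 * geo 5"
  "flat (\<lambda>x y u v. y = u) = geo 2 * geo 4 * geo 1"
  "flat (\<lambda>x y u v. y = u \<and> x = u + u + v) = geo 8 * geo 3"
  "flat (\<lambda>x y u v. y = u \<and> x = v) = geo 4 * geo 3"
  "flat (\<lambda>x y u v. x = y) = geo 4 * geo 2 * geo 1"
  "flat (\<lambda>x y u v. x = y \<and> y = u + v) = geo 6 * geo 5"
  "flat (\<lambda>x y u v. x = y \<and> y = v) = geo 2 * geo 5"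
  "flat (\<lambda>x y u v. x = y \<and> y = u) = geo 6 * geo 1"
  "flat (\<lambda>x y u v. x = y \<and> y = u \<and> u = v) = geo 7"
proof -
  show "flat (\<lambda>x y u v. True) = geo 2 * geo 2 * geo 2 * geo 1"
    using gf_pos4(1)[of 2 2 2 1]
    unfolding flat_def
    by (subst gf_image[where \<phi> = "\<lambda>(i, j, k, l). (i, j, k, l)" and B = "pos4" and w' = "\<lambda>(i, j, k,
      l). 2 * i + (2 * j + (2 * k + 1 * l))"])
      (auto simp: inj_on_def wt_def image_iff)
  show "flat (\<lambda>x y u v. x = y + u + v) = geo 4 * geo 4 * geo 3"
    using gf_pos3(1)[of 4 4 3]
    unfolding flat_def
    by (subst gf_image[where \<phi> = "\<lambda>(j, k, l). (j + k + l, j, k, l)" and B = "pos3" and w' = "\<lambda>(j,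
      k, l). 4 * j + (4 * k + 3 * l)"])
      (auto simp: inj_on_def wt_def image_iff)
  show "flat (\<lambda>x y u v. x = y + v) = geo 4 * geo 2 * geo 3"
    using gf_pos3(1)[of 4 2 3]
    unfolding flat_def
    by (subst gf_image[where \<phi> = "\<lambda>(j, k, l). (j + l, j, k, l)" and B = "pos3" and w' = "\<lambda>(j, k,
      l). 4 * j + (2 * k + 3 * l)"])
      (auto simp: inj_on_def wt_def image_iff)
  show "flat (\<lambda>x y u v. y = x + u) = geo 4 * geo 4 * geo 1"
    using gf_pos3(1)[of 4 4 1]
    unfolding flat_def
    by (subst gf_image[where \<phi> = "\<lambda>(j, k, l). (j, j + k, k, l)" and B = "pos3" and w' = "\<lambda>(j, k,
      l). 4 * j + (4 * k + 1 * l)"])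
      (auto simp: inj_on_def wt_def image_iff)
  show "flat (\<lambda>x y u v. x = u + v) = geo 2 * geo 4 * geo 3"
    using gf_pos3(1)[of 2 4 3]
    unfolding flat_def
    by (subst gf_image[where \<phi> = "\<lambda>(j, k, l). (k + l, j, k, l)" and B = "pos3" and w' = "\<lambda>(j, k,
      l). 2 * j + (4 * k + 3 * l)"])
      (auto simp: inj_on_def wt_def image_iff)
  show "flat (\<lambda>x y u v. x = u + v \<and> y = u + u + v) = geo 8 * geo 5"
    using gf_pos2(1)[of 8 5]
    unfolding flat_def
    by (subst gf_image[where \<phi> = "\<lambda>(k, l). (k + l, k + k + l, k, l)" and B = "pos2" and w' = "\<lambda>(k,
      l). 8 * k + 5 * l"])
      (auto simp: inj_on_def wt_def image_iff)
  show "flat (\<lambda>x y u v. x = u + v \<and> y = u) = geo 6 * geo 3"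
    using gf_pos2(1)[of 6 3]
    unfolding flat_def
    by (subst gf_image[where \<phi> = "\<lambda>(k, l). (k + l, k, k, l)" and B = "pos2" and w' = "\<lambda>(k, l). 6 *
      k + 3 * l"])
      (auto simp: inj_on_def wt_def image_iff)
  show "flat (\<lambda>x y u v. x = v) = geo 2 * geo 2 * geo 3"
    using gf_pos3(1)[of 2 2 3]
    unfolding flat_def
    by (subst gf_image[where \<phi> = "\<lambda>(j, k, l). (l, j, k, l)" and B = "pos3" and w' = "\<lambda>(j, k, l). 2
      * j + (2 * k + 3 * l)"])
      (auto simp: inj_on_def wt_def image_iff)
  show "flat (\<lambda>x y u v. x = v \<and> y = u + v) = geo 4 * geo 5"
    using gf_pos2(1)[of 4 5]
    unfolding flat_def
    by (subst gf_image[where \<phi> = "\<lambda>(k, l). (l, k + l, k, l)" and B = "pos2" and w' = "\<lambda>(k, l). 4 *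
      k + 5 * l"])
      (auto simp: inj_on_def wt_def image_iff)
  show "flat (\<lambda>x y u v. y = u) = geo 2 * geo 4 * geo 1"
    using gf_pos3(1)[of 2 4 1]
    unfolding flat_def
    by (subst gf_image[where \<phi> = "\<lambda>(j, k, l). (j, k, k, l)" and B = "pos3" and w' = "\<lambda>(j, k, l). 2
      * j + (4 * k + 1 * l)"])
      (auto simp: inj_on_def wt_def image_iff)
  show "flat (\<lambda>x y u v. y = u \<and> x = u + u + v) = geo 8 * geo 3"
    using gf_pos2(1)[of 8 3]
    unfolding flat_def
    by (subst gf_image[where \<phi> = "\<lambda>(k, l). (k + k + l, k, k, l)" and B = "pos2" and w' = "\<lambda>(k, l).
      8 * k + 3 * l"])
      (auto simp: inj_on_def wt_def image_iff)
  show "flat (\<lambda>x y u v. y = u \<and> x = v) = geo 4 * geo 3"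
    using gf_pos2(1)[of 4 3]
    unfolding flat_def
    by (subst gf_image[where \<phi> = "\<lambda>(k, l). (l, k, k, l)" and B = "pos2" and w' = "\<lambda>(k, l). 4 * k +
      3 * l"])
      (auto simp: inj_on_def wt_def image_iff)
  show "flat (\<lambda>x y u v. x = y) = geo 4 * geo 2 * geo 1"
    using gf_pos3(1)[of 4 2 1]
    unfolding flat_def
    by (subst gf_image[where \<phi> = "\<lambda>(j, k, l). (j, j, k, l)" and B = "pos3" and w' = "\<lambda>(j, k, l). 4
      * j + (2 * k + 1 * l)"])
      (auto simp: inj_on_def wt_def image_iff)
  show "flat (\<lambda>x y u v. x = y \<and> y = u + v) = geo 6 * geo 5"
    using gf_pos2(1)[of 6 5]
    unfolding flat_def
    by (subst gf_image[where \<phi> = "\<lambda>(k, l). (k + l, k + l, k, l)" and B = "pos2" and w' = "\<lambda>(k, l).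
      6 * k + 5 * l"])
      (auto simp: inj_on_def wt_def image_iff)
  show "flat (\<lambda>x y u v. x = y \<and> y = v) = geo 2 * geo 5"
    using gf_pos2(1)[of 2 5]
    unfolding flat_def
    by (subst gf_image[where \<phi> = "\<lambda>(k, l). (l, l, k, l)" and B = "pos2" and w' = "\<lambda>(k, l). 2 * k +
      5 * l"])
      (auto simp: inj_on_def wt_def image_iff)
  show "flat (\<lambda>x y u v. x = y \<and> y = u) = geo 6 * geo 1"
    using gf_pos2(1)[of 6 1]
    unfolding flat_def
    by (subst gf_image[where \<phi> = "\<lambda>(k, l). (k, k, k, l)" and B = "pos2" and w' = "\<lambda>(k, l). 6 * k +
      1 * l"])
      (auto simp: inj_on_def wt_def image_iff)
  show "flat (\<lambda>x y u v. x = y \<and> y = u \<and> u = v) = geo 7"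
    using gf_linear[of 7]
    unfolding flat_def
    by (subst gf_image[where \<phi> = "\<lambda>l. (l, l, l, l)" and B = "{0<..}" and w' = "\<lambda>l. 7 * l"])
      (auto simp: inj_on_def wt_def image_iff)
qed

lemma fps_gf_semimagic:
  "Abs_fps (\<lambda>t. if t > 0 then real (Sa t) else 0) = 72 * (geo 3 * (geo 2 * geo 2 * geo 2 * geo 1 -
    geo 4 * geo 4 * geo 3 - geo 4 * geo 2 * geo 3 - geo 4 * geo 4 * geo 1 - geo 2 * geo 4 * geo 3
     + geo 8 * geo 5 + 2 * geo 6 * geo 3 - geo 2 * geo 2 * geo 3 + geo 4 * geo 5 - geo 2 * geo 4 *
       geo 1
     + geo 8 * geo 3 + geo 4 * geo 3 - geo 4 * geo 2 * geo 1 + geo 6 * geo 5 + geo 2 * geo 5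
     + geo 6 * geo 1 - geo 7))"
proof -
  define V where "V = {p \<in> pos4. case p of (x, y, u, v) \<Rightarrow> generic x y u v}"
  have "generic_params = {0<..} \<times> V"
    by (auto simp: generic_params_def V_def)
  moreover have "params_sum = (\<lambda>(m, p). 3 * m + wt p)"
    by (auto simp: wt_def)
  moreover have "finite_fibres wt V"
    using finite_fibres_subset[OF finite_fibres_wt] by (auto simp: V_def)
  ultimately have gf: "gf params_sum generic_params = geo 3 * gf wt V"
    using gf_Times[of 3 wt V] by simp
  have "Abs_fps (\<lambda>t. if t > 0 then real (Sa t) else 0) = 72 * gf params_sum generic_params"
  proof (rule fps_ext)
    fix t
    \<comment> \<open>The left side sets coefficient 0 to 0 by convention; on the right it is 0
      because \<open>m > 0\<close>.\<close>
    have "card {p \<in> generic_params. params_sum p = 0} = 0"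
      by (intro card_eq_0_iff[THEN iffD2]) (auto simp: generic_params_def)
    then show "fps_nth (Abs_fps (\<lambda>t. if t > 0 then real (Sa t) else 0)) t =
        fps_nth (72 * gf params_sum generic_params) t"
      by (auto simp: gf_def Sa_eq_card_params fps_numeral_fps_const)
  qed
  also have "gf wt V = flat (\<lambda>x y u v. generic x y u v)"
    by (simp add: V_def flat_def)
  note gf[unfolded this flat_generic flat_eqs]
  finally show ?thesis by (simp only: mult_ac)
qed

section \<open>The generating function as a single fraction\<close>

lemma one_minus_fps_X_power_neq_0:
  assumes "a > 0"
  shows "1 - fps_X ^ a \<noteq> (0 :: real fps)"
proof -
  have "fps_nth (1 - fps_X ^ a :: real fps) 0 \<noteq> 0"
    using assms by (simp only: fps_sub_nth fps_X_power_nth) simp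
  then show ?thesis by (metis fps_zero_nth)
qed

text \<open>Every \<open>g a\<close> is paired with a \<open>d a\<close> from the common
  denominator, so that \<open>geo_mult\<close> can replace each pair by a power of
  \<open>fps_X\<close>. Keeping \<open>g\<close> and \<open>d\<close> abstract separates this
  regrouping from the expansion in powers of \<open>fps_X\<close>.\<close>

lemma clear_denominators:
  fixes g d :: "nat \<Rightarrow> 'a :: idom"
  shows "g 3 * (g 2 * g 2 * g 2 * g 1 - g 4 * g 4 * g 3 - g 4 * g 2 * g 3 - g 4 * g 4 * g 1 - g 2
    * g 4 * g 3
     + g 8 * g 5 + 2 * g 6 * g 3 - g 2 * g 2 * g 3 + g 4 * g 5 - g 2 * g 4 * g 1
     + g 8 * g 3 + g 4 * g 3 - g 4 * g 2 * g 1 + g 6 * g 5 + g 2 * g 5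
     + g 6 * g 1 - g 7) *
    (d 1 * d 2 ^ 3 * d 3 ^ 2 * d 4 ^ 2 * d 5 * d 6 * d 7 * d 8) =
    (g 1 * d 1) * (g 2 * d 2) ^ 3 * (g 3 * d 3) * d 3 * d 4 ^ 2 * d 5 * d 6 * d 7 * d 8
     - (g 3 * d 3) ^ 2 * (g 4 * d 4) ^ 2 * d 1 * d 2 ^ 3 * d 5 * d 6 * d 7 * d 8
     - (g 2 * d 2) * (g 3 * d 3) ^ 2 * (g 4 * d 4) * d 1 * d 2 ^ 2 * d 4 * d 5 * d 6 * d 7 * d 8
     - (g 1 * d 1) * (g 3 * d 3) * (g 4 * d 4) ^ 2 * d 2 ^ 3 * d 3 * d 5 * d 6 * d 7 * d 8
     - (g 2 * d 2) * (g 3 * d 3) ^ 2 * (g 4 * d 4) * d 1 * d 2 ^ 2 * d 4 * d 5 * d 6 * d 7 * d 8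
     + (g 3 * d 3) * (g 5 * d 5) * (g 8 * d 8) * d 1 * d 2 ^ 3 * d 3 * d 4 ^ 2 * d 6 * d 7
     + 2 * (g 3 * d 3) ^ 2 * (g 6 * d 6) * d 1 * d 2 ^ 3 * d 4 ^ 2 * d 5 * d 7 * d 8
     - (g 2 * d 2) ^ 2 * (g 3 * d 3) ^ 2 * d 1 * d 2 * d 4 ^ 2 * d 5 * d 6 * d 7 * d 8
     + (g 3 * d 3) * (g 4 * d 4) * (g 5 * d 5) * d 1 * d 2 ^ 3 * d 3 * d 4 * d 6 * d 7 * d 8
     - (g 1 * d 1) * (g 2 * d 2) * (g 3 * d 3) * (g 4 * d 4) * d 2 ^ 2 * d 3 * d 4 * d 5 * d 6 * d
       7 * d 8
     + (g 3 * d 3) ^ 2 * (g 8 * d 8) * d 1 * d 2 ^ 3 * d 4 ^ 2 * d 5 * d 6 * d 7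
     + (g 3 * d 3) ^ 2 * (g 4 * d 4) * d 1 * d 2 ^ 3 * d 4 * d 5 * d 6 * d 7 * d 8
     - (g 1 * d 1) * (g 2 * d 2) * (g 3 * d 3) * (g 4 * d 4) * d 2 ^ 2 * d 3 * d 4 * d 5 * d 6 * d
       7 * d 8
     + (g 3 * d 3) * (g 5 * d 5) * (g 6 * d 6) * d 1 * d 2 ^ 3 * d 3 * d 4 ^ 2 * d 7 * d 8
     + (g 2 * d 2) * (g 3 * d 3) * (g 5 * d 5) * d 1 * d 2 ^ 2 * d 3 * d 4 ^ 2 * d 6 * d 7 * d 8
     + (g 1 * d 1) * (g 3 * d 3) * (g 6 * d 6) * d 2 ^ 3 * d 3 * d 4 ^ 2 * d 5 * d 7 * d 8
     - (g 3 * d 3) * (g 7 * d 7) * d 1 * d 2 ^ 3 * d 3 * d 4 ^ 2 * d 5 * d 6 * d 8"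
  by algebra

lemma geo_sum_mult_denominator:
  "geo 3 * (geo 2 * geo 2 * geo 2 * geo 1 - geo 4 * geo 4 * geo 3 - geo 4 * geo 2 * geo 3 - geo 4
    * geo 4 * geo 1 - geo 2 * geo 4 * geo 3
     + geo 8 * geo 5 + 2 * geo 6 * geo 3 - geo 2 * geo 2 * geo 3 + geo 4 * geo 5 - geo 2 * geo 4 *
       geo 1
     + geo 8 * geo 3 + geo 4 * geo 3 - geo 4 * geo 2 * geo 1 + geo 6 * geo 5 + geo 2 * geo 5
     + geo 6 * geo 1 - geo 7) *
    ((1 - fps_X ^ 3) ^ 2 * (1 - fps_X ^ 4) * (1 - fps_X ^ 5) * (1 - fps_X ^ 6) *
     (1 - fps_X ^ 7) * (1 - fps_X ^ 8)) = fps_X ^ 15 * A_num fps_X"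
    (is "?L * ?D = ?N")
proof -
  let ?x = "fps_X :: real fps"
  \<comment> \<open>The surplus of the common denominator in \<open>clear_denominators\<close> over
    the stated one; it is cancelled at the end.\<close>
  let ?E = "(1 - ?x ^ 1) * (1 - ?x ^ 2) ^ 3 * (1 - ?x ^ 4)"
  have g: "geo 1 * (1 - ?x ^ 1) = ?x ^ 1" "geo 2 * (1 - ?x ^ 2) = ?x ^ 2" "geo 3 * (1 - ?x ^ 3) =
    ?x ^ 3"
    "geo 4 * (1 - ?x ^ 4) = ?x ^ 4" "geo 5 * (1 - ?x ^ 5) = ?x ^ 5" "geo 6 * (1 - ?x ^ 6) = ?x ^ 6"
    "geo 7 * (1 - ?x ^ 7) = ?x ^ 7" "geo 8 * (1 - ?x ^ 8) = ?x ^ 8"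
    by (rule geo_mult; simp)+
  note clear = clear_denominators[of geo "\<lambda>a. 1 - ?x ^ a", unfolded g]
  have "?D * ?E = (1 - ?x ^ 1) * (1 - ?x ^ 2) ^ 3 * (1 - ?x ^ 3) ^ 2 * (1 - ?x ^ 4) ^ 2 * (1 - ?x
    ^ 5) * (1 - ?x ^ 6) * (1 - ?x ^ 7) * (1 - ?x ^ 8)"
    by algebra
  then have "?L * ?D * ?E = ?L * ((1 - ?x ^ 1) * (1 - ?x ^ 2) ^ 3 * (1 - ?x ^ 3) ^ 2 * (1 - ?x ^
    4) ^ 2 * (1 - ?x ^ 5) * (1 - ?x ^ 6) * (1 - ?x ^ 7) * (1 - ?x ^ 8))"
    by (simp only: mult.assoc)
  also have "\<dots> = ?N * ?E"
    unfolding clear A_num_def by algebra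
  finally have "?L * ?D * ?E = ?N * ?E" .
  moreover have "?E \<noteq> 0"
    by (simp only: mult_eq_0_iff power_eq_0_iff one_minus_fps_X_power_neq_0 simp_thms
      zero_less_numeral zero_less_one)
  ultimately show ?thesis by (rule mult_right_cancel[THEN iffD1, rotated])
qed

lemma eq_div_of_mult_eq:
  fixes a b c :: "real fps"
  assumes "a * b = c" "b \<noteq> 0"
  shows "a = c / b"
  using assms by auto

lemma semimagic_denominator_neq_0:
  "(1 - fps_X ^ 3) ^ 2 * (1 - fps_X ^ 4) * (1 - fps_X ^ 5) * (1 - fps_X ^ 6)
     * (1 - fps_X ^ 7) * (1 - fps_X ^ 8) \<noteq> (0 :: real fps)"
  by (simp only: mult_eq_0_iff power_eq_0_iff one_minus_fps_X_power_neq_0 simp_thms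
    zero_less_numeral)

lemma fps_semimagic_mult_denominator:
  "Abs_fps (\<lambda>t. if t > 0 then real (Sa t) else 0) *
     ((1 - fps_X ^ 3) ^ 2 * (1 - fps_X ^ 4) * (1 - fps_X ^ 5) * (1 - fps_X ^ 6)
        * (1 - fps_X ^ 7) * (1 - fps_X ^ 8)) = 72 * fps_X ^ 15 * A_num fps_X"
  unfolding fps_gf_semimagic mult.assoc[of 72] geo_sum_mult_denominator ..

lemmas fps_semimagic_eq_fraction =
  eq_div_of_mult_eq[OF fps_semimagic_mult_denominator semimagic_denominator_neq_0]

section \<open>The quasipolynomial\<close>

definition b24_table :: "real list" where
  "b24_table = [1224, 2143/8, 389, 5535/8, 548, 2239/8, 1017, 1279/8, 560, 6687/8, 413, 799/8,
    1188, 2431/8, 353, 5823/8, 584, 1951/8, 1053, 991/8, 524, 6975/8, 377, 1087/8]"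

definition quasi24 :: "nat \<Rightarrow> real" where
  "quasi24 t = 1/8 * real t ^ 4 - 9/2 * real t ^ 3 + a2 t * real t ^ 2 - a1 t * real t + b24_table
    ! (t mod 24)"

text \<open>\<open>b24_table\<close> holds the values of \<open>a0\<close> at multiples of 5, where
  the second term vanishes. The splitting is checked over one full period 120.\<close>

lemma a0_eq: "a0 t = b24_table ! (t mod 24) - 144/5 * real (3 * t mod 5)"
proof -
  have "list_all (\<lambda>r. a0_table ! (r mod 20) ! (r div 20) = b24_table ! (r mod 24) - 144/5 * real
    (3 * r mod 5)) [0..<120]"
    unfolding a0_table_def b24_table_def by code_simp
  moreover have "t mod 120 \<in> set [0..<120]" by simp
  ultimately have "a0_table ! (t mod 120 mod 20) ! (t mod 120 div 20) =
      b24_table ! (t mod 120 mod 24) - 144/5 * real (3 * (t mod 120) mod 5)"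
    unfolding list_all_iff by blast
  moreover have "t mod 120 mod 20 = t mod 20" "t mod 120 mod 24 = t mod 24" by (simp_all add:
    mod_mod_cancel)
  moreover have "3 * (t mod 120) mod 5 = 3 * t mod 5"
    using mod_mult_right_eq[of 3 "t mod 120" 5] mod_mult_right_eq[of 3 t 5] by (simp add:
      mod_mod_cancel)
  ultimately show ?thesis by (simp add: a0_def)
qed

text \<open>Coefficients of \<open>(1 - X ^ 3) ^ 2 * (1 - X ^ 4) * (1 - X ^ 6) * (1 - X ^ 8)\<close>.\<close>

definition recurrence :: "(nat \<Rightarrow> real) \<Rightarrow> real" where
  "recurrence h = h 0 - 2 * h 3 - h 4 + 2 * h 7 - h 8 + 2 * h 9 + 2 * h 11 - 2 * h 13 - 2 * h 15 +
    h 16 - 2 * h 17 + h 20 + 2 * h 21 - h 24"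

text \<open>Argument \<open>j\<close> of \<open>recurrence\<close> stands for the coefficient at
  \<open>n - j\<close>; the explicit 0 for \<open>n < j\<close> is needed because subtraction on
  \<open>nat\<close> truncates.\<close>

lemma fps_nth_mult_recurrence:
  "fps_nth ((F :: real fps) * ((1 - fps_X ^ 3) ^ 2 * (1 - fps_X ^ 4) * (1 - fps_X ^ 6) * (1 -
    fps_X ^ 8))) n =
   recurrence (\<lambda>j. if n < j then 0 else fps_nth F (n - j))"
proof -
  have "F * ((1 - fps_X ^ 3) ^ 2 * (1 - fps_X ^ 4) * (1 - fps_X ^ 6) * (1 - fps_X ^ 8)) =
    F - 2 * fps_X ^ 3 * F - fps_X ^ 4 * F + 2 * fps_X ^ 7 * F - fps_X ^ 8 * F + 2 * fps_X ^ 9 * F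
      + 2 * fps_X ^ 11 * F - 2 * fps_X ^ 13 * F - 2 * fps_X ^ 15 * F + fps_X ^ 16 * F - 2 * fps_X
      ^ 17 * F + fps_X ^ 20 * F + 2 * fps_X ^ 21 * F - fps_X ^ 24 * F"
    by algebra
  then show ?thesis
    by (simp only: recurrence_def fps_nth_numeral_mult fps_X_power_mult_nth fps_add_nth
      fps_sub_nth mult.assoc
      not_less_zero if_False diff_zero)
qed

lemma recurrence_add: "recurrence (\<lambda>j. f j + g j) = recurrence f + recurrence g"
  by (simp add: recurrence_def algebra_simps)

lemma recurrence_diff: "recurrence (\<lambda>j. f j - g j) = recurrence f - recurrence g"
  by (simp add: recurrence_def algebra_simps)

lemma recurrence_cmult: "recurrence (\<lambda>j. c * f j) = c * recurrence f"
  by (simp add: recurrence_def algebra_simps)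

text \<open>The polynomial has five factors vanishing at 1, so it annihilates all polynomial
  sequences of degree below five. Lower powers carry periodic coefficients and are treated
  separately.\<close>

lemma recurrence_power:
  fixes T :: real
  shows "recurrence (\<lambda>j. (T - real j) ^ 3) = 0" "recurrence (\<lambda>j. (T - real j) ^ 4) = 0"
  unfolding recurrence_def of_nat_numeral of_nat_0 by algebra+

text \<open>Reduces a periodic coefficient at all shifts of \<open>n\<close> to finitely many
  \<open>c\<close>.\<close>

lemma ex_mod_representative:
  fixes n p :: nat
  assumes "25 \<le> n" "p > 0"
  obtains c where "c \<in> {25..<25 + p}" "\<And>j. j \<le> 24 \<Longrightarrow> (n - j) mod p = (c - j) mod p"
proof
  \<comment> \<open>The offset 25 keeps \<open>c - j\<close> positive for every shift
    \<open>j \<le> 24\<close>, so no subtraction truncates.\<close>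
  let ?c = "25 + (n - 25) mod p"
  show "?c \<in> {25..<25 + p}" using assms by simp
  fix j :: nat assume "j \<le> 24"
  have "n = p * ((n - 25) div p) + ?c" using assms by simp
  with \<open>j \<le> 24\<close> have "n - j = (?c - j) + p * ((n - 25) div p)" by linarith
  then show "(n - j) mod p = (?c - j) mod p" by (simp only: mod_mult_self2)
qed

lemma recurrence_cong: "(\<And>j. j \<le> 24 \<Longrightarrow> f j = g j) \<Longrightarrow> recurrence f = recurrence g"
  by (simp add: recurrence_def)

text \<open>\<open>a2\<close> is a sum of a function modulo 2 and one modulo 3, and at roots of
  unity of orders 1, 2, 3 the polynomial has at least triple zeros, enough for a quadratic factor.
  Since \<open>T\<close> stays symbolic, six residues remain to be checked.\<close>

lemma recurrence_a2:
  assumes "25 \<le> n"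
  shows "recurrence (\<lambda>j. a2 (n - j) * (T - real j) ^ 2) = 0"
proof -
  obtain c where c: "c \<in> {25..<31}" and mod: "\<And>j. j \<le> 24 \<Longrightarrow> (n - j) mod 6 = (c - j) mod 6"
    using ex_mod_representative[OF assms, of 6] by auto
  have "recurrence (\<lambda>j. a2 (n - j) * (T - real j) ^ 2) = recurrence (\<lambda>j. a2 (c - j) * (T - real j)
    ^ 2)"
  proof (rule recurrence_cong)
    fix j :: nat assume "j \<le> 24"
    then have "(n - j) mod 6 = (c - j) mod 6" by (rule mod)
    then show "a2 (n - j) * (T - real j) ^ 2 = a2 (c - j) * (T - real j) ^ 2" by (simp add: a2_def)
  qed
  also have "c \<in> set [25..<31]" using c by (simp only: set_upt)
  then have "recurrence (\<lambda>j. a2 (c - j) * (T - real j) ^ 2) = 0"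
    by (simp add: upt_rec) (elim disjE; simp add: recurrence_def a2_def power2_eq_square
      algebra_simps)
  finally show ?thesis .
qed

text \<open>Here \<open>a1\<close> is a sum of a function modulo 4 and one modulo 3; double zeros at
  roots of unity of orders 1, 2, 3, 4 suffice for a linear factor.\<close>

lemma recurrence_a1:
  assumes "25 \<le> n"
  shows "recurrence (\<lambda>j. a1 (n - j) * (T - real j)) = 0"
proof -
  obtain c where c: "c \<in> {25..<37}" and mod: "\<And>j. j \<le> 24 \<Longrightarrow> (n - j) mod 12 = (c - j) mod 12"
    using ex_mod_representative[OF assms, of 12] by auto
  have "recurrence (\<lambda>j. a1 (n - j) * (T - real j)) = recurrence (\<lambda>j. a1 (c - j) * (T - real j))"
  proof (rule recurrence_cong)
    fix j :: nat assume "j \<le> 24"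
    then have "(n - j) mod 12 = (c - j) mod 12" by (rule mod)
    then show "a1 (n - j) * (T - real j) = a1 (c - j) * (T - real j)" by (simp add: a1_def)
  qed
  also have "c \<in> set [25..<37]" using c by (simp only: set_upt)
  then have "recurrence (\<lambda>j. a1 (c - j) * (T - real j)) = 0"
    by (simp add: upt_rec) (elim disjE; simp add: recurrence_def a1_def algebra_simps)
  finally show ?thesis .
qed

text \<open>For a purely periodic sequence simple zeros suffice: the table has components only at
  roots of unity of orders 1, 2, 3, 4, 6, 8.\<close>

lemma recurrence_b24_table:
  assumes "25 \<le> n"
  shows "recurrence (\<lambda>j. b24_table ! ((n - j) mod 24)) = 0"
proof -
  obtain c where c: "c \<in> {25..<49}" and mod: "\<And>j. j \<le> 24 \<Longrightarrow> (n - j) mod 24 = (c - j) mod 24"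
    using ex_mod_representative[OF assms, of 24] by auto
  have "recurrence (\<lambda>j. b24_table ! ((n - j) mod 24)) = recurrence (\<lambda>j. b24_table ! ((c - j) mod
    24))"
  proof (rule recurrence_cong)
    fix j :: nat assume "j \<le> 24"
    then have "(n - j) mod 24 = (c - j) mod 24" by (rule mod)
    then show "b24_table ! ((n - j) mod 24) = b24_table ! ((c - j) mod 24)" by simp
  qed
  also have "c \<in> set [25..<49]" using c by (simp only: set_upt)
  then have "recurrence (\<lambda>j. b24_table ! ((c - j) mod 24)) = 0"
    by (simp add: upt_rec) (elim disjE; simp add: recurrence_def b24_table_def)
  finally show ?thesis .
qed

text \<open>The initial values, which determine the numerator in \<open>fps_quasi24\<close>.\<close>

lemma quasi24_values:
  "quasi24 (Suc 0) = 432/5"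
  "quasi24 2 = 144/5"
  "quasi24 3 = 576/5"
  "quasi24 4 = 288/5"
  "quasi24 5 = 0"
  "quasi24 6 = 432/5"
  "quasi24 7 = 144/5"
  "quasi24 8 = 576/5"
  "quasi24 9 = 288/5"
  "quasi24 10 = 72"
  "quasi24 11 = 432/5"
  "quasi24 12 = 144/5"
  "quasi24 13 = 936/5"
  "quasi24 14 = 288/5"
  "quasi24 15 = 72"
  "quasi24 16 = 1512/5"
  "quasi24 17 = 1944/5"
  "quasi24 18 = 3456/5"
  "quasi24 19 = 4968/5"
  "quasi24 20 = 1512"
  "quasi24 21 = 10872/5"
  "quasi24 22 = 15624/5"
  "quasi24 23 = 20376/5"
  "quasi24 24 = 30168/5"
  by (simp_all add: quasi24_def a2_def a1_def b24_table_def)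

text \<open>Coefficients from 25 on vanish by the recurrence, the earlier ones are computed. The
  factor 5 makes the numerator integral.\<close>

lemma fps_quasi24:
  "5 * Abs_fps (\<lambda>t. if t > 0 then quasi24 t else 0) *
     ((1 - fps_X ^ 3) ^ 2 * (1 - fps_X ^ 4) * (1 - fps_X ^ 6) * (1 - fps_X ^ 8)) =
   432 * fps_X ^ 1 + 144 * fps_X ^ 2 + 576 * fps_X ^ 3 - 576 * fps_X ^ 4 - 720 * fps_X ^ 5 - 864 *
     fps_X ^ 6 - 1008 * fps_X ^ 7 + 1152 * fps_X ^ 8 - 720 * fps_X ^ 9 + 1512 * fps_X ^ 10 - 576 *
     fps_X ^ 11 + 720 * fps_X ^ 12 + 1656 * fps_X ^ 13 - 792 * fps_X ^ 14 + 1800 * fps_X ^ 15 -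
     2232 * fps_X ^ 16 + 2448 * fps_X ^ 17 + 1944 * fps_X ^ 18 + 2160 * fps_X ^ 19 + 4176 * fps_X
     ^ 20 + 504 * fps_X ^ 21 + 5976 * fps_X ^ 22 + 2088 * fps_X ^ 23 + 6120 * fps_X ^ 24"
   (is "5 * ?H * ?D = ?N")
proof (rule fps_ext)
  fix n
  let ?h = "\<lambda>n j. if n < j then 0 else if n - j > 0 then quasi24 (n - j) else 0"
  have "fps_nth (5 * ?H * ?D) n = 5 * recurrence (?h n)"
    by (simp only: mult.assoc[of 5] fps_nth_numeral_mult fps_nth_mult_recurrence fps_nth_Abs_fps)
  also have "\<dots> = fps_nth ?N n"
  \<comment> \<open>The split is at 25, not 24: for \<open>n = 24\<close> the last shift meets index
    0, where the series has coefficient 0 instead of \<open>quasi24 0\<close>.\<close>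
  proof (cases "n < 25")
    case True
    then have "n \<in> {..<25}" by simp
    then show ?thesis
      by (simp only: lessThan_nat_numeral pred_numeral_simps arith_simps lessThan_Suc lessThan_0
        One_nat_def insert_iff empty_iff)
        (elim disjE; simp add: recurrence_def quasi24_values fps_nth_numeral_mult fps_X_power_nth
          fps_numeral_nth)
  next
    case False
    then have n: "25 \<le> n" by simp
    have "recurrence (?h n) = recurrence (\<lambda>j. 1/8 * (real n - real j) ^ 4 - 9/2 * (real n - real
      j) ^ 3
        + a2 (n - j) * (real n - real j) ^ 2 - a1 (n - j) * (real n - real j) + b24_table ! ((n -
          j) mod 24))"
      by (rule recurrence_cong) (use n in \<open>simp add: quasi24_def of_nat_diff\<close>)
    also have "\<dots> = 0"
      unfolding recurrence_add recurrence_diff recurrence_cmult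
      by (simp only: recurrence_power recurrence_a2[OF n] recurrence_a1[OF n]
        recurrence_b24_table[OF n])
    finally show ?thesis using False by (simp add: fps_nth_numeral_mult fps_X_power_nth
      fps_numeral_nth)
  qed
  finally show "fps_nth (5 * ?H * ?D) n = fps_nth ?N n" .
qed

text \<open>The sequence has period 5, so multiplying by \<open>1 - X^5\<close> leaves its first
  period, with residues 3, 1, 4, 2, 0.\<close>

lemma fps_quintic:
  "5 * Abs_fps (\<lambda>t. if t > 0 then - 144/5 * real (3 * t mod 5) else 0) * (1 - fps_X ^ 5) =
   - 144 * (3 * fps_X + fps_X ^ 2 + 4 * fps_X ^ 3 + 2 * fps_X ^ 4)"
   (is "5 * ?H * _ = ?N")
proof -
  have "5 * ?H * (1 - fps_X ^ 5) = 5 * (?H - fps_X ^ 5 * ?H)" by algebra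
  also have "\<dots> = - (144 * (3 * fps_X ^ 1 + fps_X ^ 2 + 4 * fps_X ^ 3 + 2 * fps_X ^ 4))"
  proof (rule fps_ext)
    fix n
    show "fps_nth (5 * (?H - fps_X ^ 5 * ?H)) n =
      fps_nth (- (144 * (3 * fps_X ^ 1 + fps_X ^ 2 + 4 * fps_X ^ 3 + 2 * fps_X ^ 4))) n"
    \<comment> \<open>From 6 on, \<open>n - 5\<close> is positive and the value 0 set at index 0
      does not interfere.\<close>
    proof (cases "n < 6")
      case True
      then have "n \<in> set [0..<6]" by simp
      then show ?thesis
        by (simp add: upt_rec) (elim disjE; simp add: fps_nth_numeral_mult fps_X_power_mult_nth
          fps_X_power_nth fps_numeral_nth del: power_one_right)
    next
      case False
      have "3 * n = 3 * (n - 5) + 5 * 3" using False by simp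
      then have "3 * (n - 5) mod 5 = 3 * n mod 5" by (simp only: mod_mult_self2)
      then show ?thesis using False
        by (simp add: fps_nth_numeral_mult fps_X_power_mult_nth fps_X_power_nth fps_numeral_nth
          del: power_one_right)
    qed
  qed
  finally show ?thesis by simp
qed

lemma S7_eq: "t > 0 \<Longrightarrow> S7 t = (int t - 1) div 21 + eps7 t"
proof -
  have "(real t - 1) / 21 = real_of_int (int t - 1) / real_of_int 21" by simp
  then show ?thesis unfolding S7_def by (simp only: floor_divide_of_int_eq)
qed

lemma S7_add: "S7 (21 * k + m) = int k + S7 m"
proof -
  have "(real (21 * k + m) - 1) / 21 = (real m - 1) / 21 + of_int (int k)" by (simp add:
    field_simps)
  moreover have "eps7 (21 * k + m) = eps7 m" by (simp add: eps7_def)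
  moreover have "\<lfloor>(real m - 1) / 21 + of_int (int k)\<rfloor> = \<lfloor>(real m - 1) / 21\<rfloor> + int k"
    by (rule floor_add_int[symmetric])
  ultimately show ?thesis unfolding S7_def by linarith
qed

text \<open>Equivalently, the series of \<open>S7\<close> is \<open>geo 3 * geo 7\<close>. Large
  \<open>n\<close> are reduced by \<open>S7_add\<close> to one period.\<close>

lemma fps_S7:
  "Abs_fps (\<lambda>t. if t > 0 then real_of_int (S7 t) else 0) * ((1 - fps_X ^ 3) * (1 - fps_X ^ 7)) =
    fps_X ^ 10"
   (is "?H * _ = _")
proof -
  have S7: "real_of_int (S7 m) = real_of_int ((int m - 1) div 21 + eps7 m)" if "m > 0" for m
    using S7_eq[OF that] by simp
  have "?H * ((1 - fps_X ^ 3) * (1 - fps_X ^ 7)) =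
      ?H - fps_X ^ 3 * ?H - fps_X ^ 7 * ?H + fps_X ^ 10 * ?H" by algebra
  also have "\<dots> = fps_X ^ 10"
  proof (rule fps_ext)
    fix n
    show "fps_nth (?H - fps_X ^ 3 * ?H - fps_X ^ 7 * ?H + fps_X ^ 10 * ?H) n = fps_nth (fps_X ^
      10) n"
    \<comment> \<open>From 11 on, all of \<open>n\<close>, \<open>n - 3\<close>,
      \<open>n - 7\<close>, \<open>n - 10\<close> are positive.\<close>
    proof (cases "n < 11")
      case True
      then have "n \<in> set [0..<11]" by simp
      then show ?thesis
        by (simp add: upt_rec) (elim disjE; simp add: fps_X_power_mult_nth fps_X_power_nth S7
          eps7_def)
    next
      case False
      define k c where "k = (n - 11) div 21" and "c = 11 + (n - 11) mod 21"
      have n: "n = 21 * k + c" using False by (simp add: k_def c_def)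
      \<comment> \<open>Simplified forms of the index \<open>n - 10\<close> for
        \<open>c = 11\<close> and \<open>c = 12\<close>, to which \<open>S7_add\<close> does not
        apply syntactically.\<close>
      have S7_Suc: "S7 (Suc (21 * k)) = int k + S7 1" "S7 (Suc (Suc (21 * k))) = int k + S7 2"
        using S7_add[of k 1] S7_add[of k 2] by simp_all
      have "c \<in> set [11..<32]" by (simp only: set_upt atLeastLessThan_iff) (simp add: c_def)
      then show ?thesis unfolding n
        by (simp add: upt_rec) (elim disjE; simp add: fps_X_power_mult_nth fps_X_power_nth S7_add
          S7_Suc S7 eps7_def)
    qed
  qed
  finally show ?thesis .
qed

theorem Sa_eq_quasipolynomial:
  assumes "t \<ge> 1"
  shows "real (Sa t) = 1/8 * real t ^ 4 - 9/2 * real t ^ 3 + a2 t * real t ^ 2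
             - a1 t * real t + a0 t - 72 * real_of_int (S7 t)"
proof -
  let ?x = "fps_X :: real fps"
  let ?D = "(1 - ?x ^ 3) ^ 2 * (1 - ?x ^ 4) * (1 - ?x ^ 5) * (1 - ?x ^ 6) * (1 - ?x ^ 7) * (1 - ?x
    ^ 8)"
  define F H P S :: "real fps" where "F = Abs_fps (\<lambda>t. if t > 0 then real (Sa t) else 0)"
    and "H = Abs_fps (\<lambda>t. if t > 0 then quasi24 t else 0)"
    and "P = Abs_fps (\<lambda>t. if t > 0 then - 144/5 * real (3 * t mod 5) else 0)"
    and "S = Abs_fps (\<lambda>t. if t > 0 then real_of_int (S7 t) else 0)"
  note folds = this[symmetric]
  \<comment> \<open>Each part absorbs from \<open>?D\<close> the factors of its own denominator; the
    rest is a cofactor. Here 360 is 5 * 72.\<close>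
  have "5 * (H + P - 72 * S) * ?D =
      (5 * H * ((1 - ?x ^ 3) ^ 2 * (1 - ?x ^ 4) * (1 - ?x ^ 6) * (1 - ?x ^ 8))) * ((1 - ?x ^ 5) *
        (1 - ?x ^ 7))
      + (5 * P * (1 - ?x ^ 5)) * ((1 - ?x ^ 3) ^ 2 * (1 - ?x ^ 4) * (1 - ?x ^ 6) * (1 - ?x ^ 7) *
        (1 - ?x ^ 8))
      - 360 * (S * ((1 - ?x ^ 3) * (1 - ?x ^ 7))) * ((1 - ?x ^ 3) * (1 - ?x ^ 4) * (1 - ?x ^ 5) *
        (1 - ?x ^ 6) * (1 - ?x ^ 8))"
    by algebra
  also have "\<dots> = 5 * (72 * ?x ^ 15 * A_num ?x)"
    unfolding fps_quasi24[unfolded folds] fps_quintic[unfolded folds] fps_S7[unfolded folds]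
      A_num_def
    by algebra
  also have "\<dots> = 5 * (F * ?D)"
    using fps_semimagic_mult_denominator[unfolded folds] by (simp only:)
  finally have "5 * (H + P - 72 * S) * ?D = 5 * F * ?D"
    by (simp only: mult.assoc)
  then have "5 * (H + P - 72 * S) = 5 * F"
    by (rule mult_right_cancel[THEN iffD1, OF semimagic_denominator_neq_0])
  then have "fps_nth (5 * (H + P - 72 * S)) t = fps_nth (5 * F) t" by (rule arg_cong)
  then have "fps_nth H t + fps_nth P t - 72 * fps_nth S t = fps_nth F t"
    unfolding fps_nth_numeral_mult fps_add_nth fps_sub_nth by simp
  then have "quasi24 t + - 144/5 * real (3 * t mod 5) - 72 * real_of_int (S7 t) = real (Sa t)"
    using assms unfolding F_def H_def P_def S_def fps_nth_Abs_fps by simp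
  then show ?thesis unfolding quasi24_def a0_eq by linarith
qed

section \<open>Constituents and the exact period\<close>

definition constituent :: "nat \<Rightarrow> real poly" where
  "constituent r = [:a0 r - 72 * (real_of_int (S7 r) - real r / 21), - (a1 r + 24/7), a2 r, -
    (9/2), 1/8:]"

text \<open>840 is the least common multiple of 120 and 21. Along a residue class modulo 840 the
  difference \<open>S7 t - t / 21\<close> is constant, so \<open>- 72 * S7 t\<close> contributes
  slope \<open>- 24/7\<close> and a constant.\<close>

lemma constituent_mod: "poly (constituent (t mod 840)) (real t) =
    1/8 * real t ^ 4 - 9/2 * real t ^ 3 + a2 t * real t ^ 2 - a1 t * real t + a0 t - 72 *
      real_of_int (S7 t)"
proof -
  define k r where "k = t div 840" and "r = t mod 840"
  have t: "t = 21 * (40 * k) + r" by (simp add: k_def r_def)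
  have "r mod 6 = t mod 6" "r mod 12 = t mod 12" "r mod 20 = t mod 20" "r mod 120 = t mod 120"
    by (simp_all add: r_def mod_mod_cancel)
  then have eqs: "a2 r = a2 t" "a1 r = a1 t" "a0 r = a0 t"
    by (simp_all add: a2_def a1_def a0_def)
  have "real_of_int (S7 t) = 40 * real k + real_of_int (S7 r)" unfolding t S7_add by simp
  moreover have "real t = 840 * real k + real r" by (simp add: t)
  moreover have "poly (constituent r) (real t) = 1/8 * real t ^ 4 - 9/2 * real t ^ 3 + a2 r * real
    t ^ 2 - a1 r * real t - 24/7 * real t
      + (a0 r - 72 * (real_of_int (S7 r) - real r / 21))"
    unfolding constituent_def by (simp add: algebra_simps eval_nat_numeral)
  ultimately show ?thesis unfolding eqs r_def[symmetric] by algebra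
qed

lemma has_constituents_Sa: "has_constituents (\<lambda>t. real (Sa t)) 840 constituent"
  unfolding has_constituents_def constituent_mod using Sa_eq_quasipolynomial by simp

text \<open>Two quasipolynomial representations agree, constituent by constituent, along the common
  progression \<open>t + p q n\<close>; so every period \<open>q\<close> is a period of the constituents.\<close>

lemma has_constituents_unique:
  assumes c: "has_constituents N p c" and d: "has_constituents N q d"
  shows "c (t mod p) = d (t mod q)"
proof -
  have pq: "p > 0" "q > 0" using assms by (auto simp: has_constituents_def)
  have eq: "poly (c (t mod p) - d (t mod q)) (real (t + p * q * Suc n)) = 0" for n
  proof -
    let ?m = "t + p * q * Suc n"
    have "?m > 0" using pq by simp
    moreover have "?m mod p = t mod p" by (simp only: mult.assoc mod_mult_self2)
    moreover have "?m mod q = t mod q" by (simp only: mult.assoc mult.left_commute[of p]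
      mod_mult_self2)
    ultimately have "N ?m = poly (c (t mod p)) (real ?m)" "N ?m = poly (d (t mod q)) (real ?m)"
      using c d unfolding has_constituents_def by metis+
    then show ?thesis by simp
  qed
  have "inj (\<lambda>n. real (t + p * q * Suc n))" using pq by (auto intro!: injI)
  then have "infinite (range (\<lambda>n. real (t + p * q * Suc n)))" by (rule range_inj_infinite)
  moreover have "range (\<lambda>n. real (t + p * q * Suc n)) \<subseteq> {x. poly (c (t mod p) - d (t mod q)) x = 0}"
    using eq by blast
  ultimately have "infinite {x. poly (c (t mod p) - d (t mod q)) x = 0}" using infinite_super by
    blast
  then show ?thesis using poly_roots_finite[of "c (t mod p) - d (t mod q)"] by auto
qed

text \<open>A period \<open>q\<close> makes the constituents at all multiples of \<open>q\<close>,
  hence of \<open>gcd q 840\<close>, equal to the one at 0. If \<open>q < 840\<close>, this gcd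
  divides \<open>840 / p\<close> for a prime \<open>p\<close>, so one of four constituents would
  equal the principal one.\<close>

lemma period_Sa_le:
  assumes d: "has_constituents (\<lambda>t. real (Sa t)) q d"
  shows "840 \<le> q"
proof (rule ccontr)
  assume "\<not> 840 \<le> q"
  moreover have "q > 0" using d by (simp add: has_constituents_def)
  ultimately have q: "0 < q" "q < 840" by auto
  have per: "constituent (m * q mod 840) = constituent 0" for m
    using has_constituents_unique[OF has_constituents_Sa d, of "m * q"]
      has_constituents_unique[OF has_constituents_Sa d, of 0] by simp
  have gcd: "constituent (m * gcd q 840 mod 840) = constituent 0" for m
  proof -
    \<comment> \<open>Bezout: modulo 840 the gcd is itself a multiple of \<open>q\<close>.\<close>
    obtain x where "[q * x = gcd q 840] (mod 840)"
      using cong_solve_nat[of q 840] by blast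
    then have "[m * (q * x) = m * gcd q 840] (mod 840)" by (rule cong_scalar_left)
    then have "m * gcd q 840 mod 840 = (m * x) * q mod 840" by (simp add: cong_def mult_ac)
    then show ?thesis using per by metis
  qed
  obtain m where m: "840 = gcd q 840 * m" by (metis dvd_def gcd_dvd2)
  have "m \<noteq> 1"
  proof
    assume "m = 1"
    with m have "840 dvd q" by (metis gcd_dvd1 mult.right_neutral)
    with q show False using dvd_imp_le by fastforce
  qed
  then obtain p where p: "prime p" "p dvd m" using prime_factor_nat by blast
  then obtain l where l: "m = p * l" by blast
  have "p dvd 840" using m p(2) by (metis dvd_mult)
  then have "p dvd 2 * 2 * 2 * 3 * 5 * 7" by simp
  then have "p dvd 2 \<or> p dvd 3 \<or> p dvd 5 \<or> p dvd 7"
    unfolding prime_dvd_mult_iff[OF p(1)] by blast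
  then have "p \<in> {2, 3, 5, 7}"
    using primes_dvd_imp_eq[OF p(1)] by auto
  \<comment> \<open>This product is \<open>840 / p\<close>.\<close>
  then have "l * gcd q 840 \<in> {420, 280, 168, 120}" using m l by auto
  then have "constituent 420 = constituent 0 \<or> constituent 280 = constituent 0 \<or>
      constituent 168 = constituent 0 \<or> constituent 120 = constituent 0"
    using gcd[of l] by auto
  \<comment> \<open>All four differ from \<open>constituent 0\<close> already in the constant
    term.\<close>
  then show False
    by (simp add: constituent_def a2_def a1_def a0_def a0_table_def S7_def eps7_def)
qed

lemma quasi_period_Sa: "quasi_period (\<lambda>t. real (Sa t)) = 840"
  unfolding quasi_period_def
  by (rule Least_equality) (use has_constituents_Sa period_Sa_le in blast)+

lemma principal_constituent_Sa:
  "principal_constituent (\<lambda>t. real (Sa t)) = [:1296, - (13896/35), 243/4, - (9/2), 1/8:]"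
  unfolding principal_constituent_eq[OF has_constituents_Sa]
  \<comment> \<open>\<open>S7 0\<close> is -1 by the floor, so the constant term is 1224 + 72 rather
    than \<open>a0 0\<close>.\<close>
  by (simp add: constituent_def a2_def a1_def a0_def a0_table_def S7_def eps7_def)

theorem mainTheorem4:
  shows "Abs_fps (\<lambda>t. if t > 0 then real (Sa t) else 0) =
           72 * fps_X ^ 15 * A_num fps_X /
           ((1 - fps_X ^ 3) ^ 2 * (1 - fps_X ^ 4) * (1 - fps_X ^ 5) * (1 - fps_X ^ 6)
              * (1 - fps_X ^ 7) * (1 - fps_X ^ 8))
       \<and> (\<forall>t::nat. t \<ge> 1 \<longrightarrow>
           real (Sa t) = 1/8 * real t ^ 4 - 9/2 * real t ^ 3 + a2 t * real t ^ 2
             - a1 t * real t + a0 t - 72 * real_of_int (S7 t))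
       \<and> quasipolynomial (\<lambda>t. real (Sa t))
       \<and> quasi_period (\<lambda>t. real (Sa t)) = 840
       \<and> principal_constituent (\<lambda>t. real (Sa t)) = [:1296, - (13896/35), 243/4, - (9/2), 1/8:]"
  using fps_semimagic_eq_fraction Sa_eq_quasipolynomial has_constituents_Sa quasi_period_Sa
    principal_constituent_Sa
  unfolding quasipolynomial_def by blast

end
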